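(* Let $\Gamma$ be a metric graph, let $q\in\Gamma$, and let $D$ be a divisor on $\Gamma$ such that $D(p)\ge 0$ for all $p\in\Gamma$ with $p\ne q$. Then any (transfinite) greedy reduction of $D$ with respect to $q$ takes at most $\omega^{\deg(D)}$ steps, where $\deg(D)=\sum_{p\in\Gamma}D(p)$ is the degree of $D$.
   Context: A metric graph $\Gamma$ is a compact connected metric space obtained from a finite edge-weighted graph by viewing each edge of weight $w>0$ as a segment of length $w$. The degree of a point $p\in\Gamma$ is the number of tangent directions at $p$; a combinatorial vertex is a point of degree other than $2$. A divisor $D$ on $\Gamma$ is a formal integer combination of points of $\Gamma$ with finitely many nonzero coefficients; $D(p)$ is the coefficient at $p$ (the number of chips at $p$, possibly negative). Fix $q\in\Gamma$. A (basic) firing $f$ towards $q$ of length $\epsilon=\epsilon(f)>0$ is given by two disjoint nonempty connected closed subsets $X,Y\subset\Gamma$ with $q\in X$ such that $Z=\Gamma\setminus(X\cup Y)$ is a disjoint union of finitely many open segments of length $\epsilon$, each having one endpoint in $X$ and the other in $Y$. The associated function $f:\Gamma\to\mathbb{R}$ is the piecewise affine function equal to $0$ on $X$, equal to $\epsilon$ on $Y$, and of slope $1$ on each segment of $Z$ in the direction from $X$ to $Y$. The divisor $Q(f)$ is $\sum_{I}\big((y_I)-(x_I)\big)$, the sum being over the segments $I$ of $Z$, where $x_I\in X$ and $y_I\in Y$ are the endpoints of $I$. Thus passing from $D$ to $D-Q(f)$ pushes one chip along each segment of the cut $Z$ a distance $\epsilon$ from $Y$ to $X$, i.e. towards $q$.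 For a divisor $D$ with $D(p)\ge0$ for all $p\neq q$, the firing $f$ is legal for $D$ if $D-Q(f)$ is also nonnegative at all points other than $q$. It is a maximal legal firing for $D$ if it is legal and is taken to have maximum length for the given cut, i.e. it describes a push of chips along a cut so that at least one of the chips hits a combinatorial vertex and therefore cannot be pushed any further without choosing a different cut. Transfinite greedy reduction: for an ordinal $\alpha$, a greedy reduction of $D$ with respect to $q$ taking $\alpha$ steps is a family of divisors $(D_\beta)_{\beta\le\alpha}$ with $D_0=D$; for every $\beta<\alpha$, $D_{\beta+1}=D_\beta-Q(f_\beta)$ where $f_\beta$ is a maximal legal firing towards $q$ for $D_\beta$; and for every limit ordinal $\lambda\le\alpha$, $D_\lambda$ is the limit of $D_\beta$ as $\beta\to\lambda$, $\beta<\lambda$. Convergence of divisors is meant as follows: with $N=\max(0,-D(q))$ every $D_\beta+N(q)$ is a sum of a fixed number $m$ of points of $\Gamma$ (chips), and $D_\beta\to D_\lambda$ means that the chips can be labelled, $D_\beta+N(q)=\sum_{j=1}^m(x_{\beta,j})$ and $D_\lambda+N(q)=\sum_{j=1}^m(x_{\lambda,j})$, so that $x_{\beta,j}\to x_{\lambda,j}$ in $\Gamma$ for each $j$.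
   Formalization: The exponent deg(D) is replaced by deg(D)+max(0,-D(q)), which equals deg(D) if D(q)≥0; for D(q)<0 the bound as stated fails, e.g. on a 3-leaf star with D=(p)-(q), p and q leaves, where deg(D)=0 but two steps are possible. *)

theory Defs
  imports "HOL-Analysis.Analysis" "HOL-Library.Poly_Mapping"
begin

section \<open>Metric graphs\<close>

text \<open>
  A model of a metric graph consists of a finite set \<open>V\<close> of points, finitely many edges
  \<open>e < n\<close> of length \<open>w e\<close>, and for each edge a map \<open>\<phi> e\<close> from \<open>{0..w e}\<close> that glues the
  segment into the graph (loops and multiple edges are allowed, and \<open>V\<close> may contain
  points of degree 2). The inductive predicate describes the ways of travelling along the
  edges, together with the distance travelled; its infimum is the path metric.
\<close>

inductive edge_walk :: "'a set \<Rightarrow> nat \<Rightarrow> (nat \<Rightarrow> real) \<Rightarrow> (nat \<Rightarrow> real \<Rightarrow> 'a) \<Rightarrow> 'a \<Rightarrow> 'a \<Rightarrow> real \<Rightarrow> bool"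
  for \<Gamma> n w \<phi> where
  stay: "x \<in> \<Gamma> \<Longrightarrow> edge_walk \<Gamma> n w \<phi> x x 0"
| move: "edge_walk \<Gamma> n w \<phi> x (\<phi> e s) L \<Longrightarrow> e < n \<Longrightarrow> s \<in> {0..w e} \<Longrightarrow> t \<in> {0..w e}
    \<Longrightarrow> edge_walk \<Gamma> n w \<phi> x (\<phi> e t) (L + \<bar>s - t\<bar>)"

definition graph_model ::
    "'a::metric_space set \<Rightarrow> 'a set \<Rightarrow> nat \<Rightarrow> (nat \<Rightarrow> real) \<Rightarrow> (nat \<Rightarrow> real \<Rightarrow> 'a) \<Rightarrow> bool" where
  "graph_model \<Gamma> V n w \<phi> \<longleftrightarrow>
     finite V \<and> V \<noteq> {} \<and>
     (\<forall>e<n. 0 < w e \<and> \<phi> e 0 \<in> V \<and> \<phi> e (w e) \<in> V \<and>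
            inj_on (\<phi> e) {0<..<w e} \<and> \<phi> e ` {0<..<w e} \<inter> V = {}) \<and>
     disjoint_family_on (\<lambda>e. \<phi> e ` {0<..<w e}) {..<n} \<and>
     \<Gamma> = V \<union> (\<Union>e<n. \<phi> e ` {0..w e}) \<and>
     (\<forall>x\<in>\<Gamma>. \<forall>y\<in>\<Gamma>. (\<exists>L. edge_walk \<Gamma> n w \<phi> x y L) \<and>
                     dist x y = Inf {L. edge_walk \<Gamma> n w \<phi> x y L})"

definition metric_graph :: "'a::metric_space set \<Rightarrow> bool" where
  "metric_graph \<Gamma> \<longleftrightarrow> (\<exists>V n w \<phi>. graph_model \<Gamma> V n w \<phi>)"

lemma edge_walk_nonneg: "edge_walk \<Gamma> n w \<phi> x y L \<Longrightarrow> 0 \<le> L"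
  by (induction rule: edge_walk.induct) auto

lemma graph_model_edge_subset:
  assumes "graph_model \<Gamma> V n w \<phi>" "e < n"
  shows "\<phi> e ` {0..w e} \<subseteq> \<Gamma>"
proof -
  have "\<Gamma> = V \<union> (\<Union>e<n. \<phi> e ` {0..w e})"
    using assms(1) unfolding graph_model_def by (elim conjE)
  moreover have "\<phi> e ` {0..w e} \<subseteq> (\<Union>e<n. \<phi> e ` {0..w e})"
    using assms(2) by (intro UN_upper) simp
  ultimately show ?thesis by (simp add: le_supI2)
qed

lemma graph_model_edge_dist:
  assumes "graph_model \<Gamma> V n w \<phi>" "e < n" "s \<in> {0..w e}" "t \<in> {0..w e}"
  shows "dist (\<phi> e s) (\<phi> e t) \<le> \<bar>s - t\<bar>"
proof -
  have in\<Gamma>: "\<phi> e s \<in> \<Gamma>" "\<phi> e t \<in> \<Gamma>"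
    using graph_model_edge_subset[OF assms(1,2)] assms(3,4) by (simp_all add: image_subset_iff)
  have "edge_walk \<Gamma> n w \<phi> (\<phi> e s) (\<phi> e t) (0 + \<bar>s - t\<bar>)"
    by (rule edge_walk.move[OF edge_walk.stay]) (use assms in\<Gamma> in auto)
  moreover have "bdd_below {L. edge_walk \<Gamma> n w \<phi> (\<phi> e s) (\<phi> e t) L}"
    by (rule bdd_belowI[of _ 0]) (auto dest: edge_walk_nonneg)
  moreover have "dist (\<phi> e s) (\<phi> e t) = Inf {L. edge_walk \<Gamma> n w \<phi> (\<phi> e s) (\<phi> e t) L}"
    using assms in\<Gamma> unfolding graph_model_def by blast
  ultimately show ?thesis by (simp add: cInf_lower)
qed

lemma graph_model_edge_continuous:
  assumes "graph_model \<Gamma> V n w \<phi>" "e < n"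
  shows "continuous_on {0..w e} (\<phi> e)"
  unfolding continuous_on_iff
proof (intro ballI allI impI)
  fix x d :: real assume x: "x \<in> {0..w e}" and "0 < d"
  then show "\<exists>d'>0. \<forall>x'\<in>{0..w e}. dist x' x < d' \<longrightarrow> dist (\<phi> e x') (\<phi> e x) < d"
    using graph_model_edge_dist[OF assms] x
    by (intro exI[of _ d]) (force simp: dist_real_def)
qed

lemma metric_graph_compact: "metric_graph \<Gamma> \<Longrightarrow> compact \<Gamma>"
proof -
  assume "metric_graph \<Gamma>"
  then obtain V n w \<phi> where M: "graph_model \<Gamma> V n w \<phi>"
    unfolding metric_graph_def by blast
  have "compact (V \<union> (\<Union>e<n. \<phi> e ` {0..w e}))"
  proof (intro compact_Un compact_UN)
    show "compact V" using M by (simp add: graph_model_def finite_imp_compact)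
    show "compact (\<phi> e ` {0..w e})" if "e \<in> {..<n}" for e
      using that by (intro compact_continuous_image graph_model_edge_continuous[OF M]) auto
  qed auto
  then show ?thesis using M by (simp add: graph_model_def)
qed

lemma metric_graph_connected: "metric_graph \<Gamma> \<Longrightarrow> connected \<Gamma>"
proof -
  assume "metric_graph \<Gamma>"
  then obtain V n w \<phi> where M: "graph_model \<Gamma> V n w \<phi>"
    unfolding metric_graph_def by blast
  have walk: "\<exists>T. connected T \<and> T \<subseteq> \<Gamma> \<and> x \<in> T \<and> y \<in> T"
    if "edge_walk \<Gamma> n w \<phi> x y L" for x y L
    using that
  proof induction
    case (stay x)
    then show ?case by (intro exI[of _ "{x}"]) auto
  next
    case (move x e s L t)
    obtain T where T: "connected T" "T \<subseteq> \<Gamma>" "x \<in> T" "\<phi> e s \<in> T"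
      using move.IH by (elim exE conjE)
    let ?I = "\<phi> e ` {0..w e}"
    have I: "connected ?I" "?I \<subseteq> \<Gamma>" "\<phi> e s \<in> ?I" "\<phi> e t \<in> ?I"
    proof -
      show "connected ?I"
        using move.hyps by (intro connected_continuous_image graph_model_edge_continuous[OF M] connected_Icc)
      show "?I \<subseteq> \<Gamma>" by (rule graph_model_edge_subset[OF M \<open>e < n\<close>])
      show "\<phi> e s \<in> ?I" "\<phi> e t \<in> ?I" using move.hyps by (simp_all only: imageI)
    qed
    have "connected (T \<union> ?I)"
    proof (rule connected_Un)
      show "T \<inter> ?I \<noteq> {}" using T(4) I(3) by blast
    qed (rule T I)+
    then show ?case using T I by (intro exI[of _ "T \<union> ?I"]) simp
  qed
  show ?thesis
  proof (rule connected_iff_connected_component[THEN iffD2], intro ballI)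
    fix x y assume "x \<in> \<Gamma>" "y \<in> \<Gamma>"
    moreover have "\<forall>x\<in>\<Gamma>. \<forall>y\<in>\<Gamma>. (\<exists>L. edge_walk \<Gamma> n w \<phi> x y L) \<and>
        dist x y = Inf {L. edge_walk \<Gamma> n w \<phi> x y L}"
      using M unfolding graph_model_def by (elim conjE)
    ultimately obtain L where "edge_walk \<Gamma> n w \<phi> x y L" by fast
    then show "connected_component \<Gamma> x y"
      unfolding connected_component_def by (rule walk)
  qed
qed


section \<open>Divisors and firings\<close>

type_synonym 'a divisor = "'a \<Rightarrow>\<^sub>0 int"

definition is_divisor_on :: "'a set \<Rightarrow> 'a divisor \<Rightarrow> bool" where
  "is_divisor_on \<Gamma> D \<longleftrightarrow> Poly_Mapping.keys D \<subseteq> \<Gamma>"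

abbreviation coeff_at :: "'a divisor \<Rightarrow> 'a \<Rightarrow> int" where
  "coeff_at \<equiv> Poly_Mapping.lookup"

abbreviation chip :: "'a \<Rightarrow> 'a divisor" where
  "chip p \<equiv> Poly_Mapping.single p 1"

definition div_deg :: "'a divisor \<Rightarrow> int" where
  "div_deg D = (\<Sum>p\<in>Poly_Mapping.keys D. coeff_at D p)"

text \<open>
  A parametrization by arc length of an open segment of length \<open>\<epsilon>\<close>; its two endpoints are
  \<open>\<sigma> 0\<close> and \<open>\<sigma> \<epsilon>\<close>. They may coincide with each other or with endpoints of other
  segments, and \<open>\<sigma>\<close> is in general only locally an isometry, since \<open>\<Gamma>\<close> may contain a shorter
  way between two points of the segment.
\<close>

definition segment_param :: "'a::metric_space set \<Rightarrow> real \<Rightarrow> (real \<Rightarrow> 'a) \<Rightarrow> bool" where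
  "segment_param \<Gamma> \<epsilon> \<sigma> \<longleftrightarrow>
     \<sigma> ` {0..\<epsilon>} \<subseteq> \<Gamma> \<and> continuous_on {0..\<epsilon>} \<sigma> \<and> inj_on \<sigma> {0<..<\<epsilon>} \<and>
     (\<forall>t\<in>{0<..<\<epsilon>}. \<exists>\<delta>>0. \<forall>s\<in>{0<..<\<epsilon>}. \<forall>u\<in>{0<..<\<epsilon>}.
        \<bar>s - t\<bar> < \<delta> \<longrightarrow> \<bar>u - t\<bar> < \<delta> \<longrightarrow> dist (\<sigma> s) (\<sigma> u) = \<bar>s - u\<bar>)"

text \<open>
  In a firing, \<open>near\<close> is the part \<open>X\<close> containing \<open>q\<close>, \<open>far\<close> is \<open>Y\<close>, and every segment of
  the cut is parametrized from its endpoint in \<open>X\<close> to its endpoint in \<open>Y\<close>.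
\<close>

record 'a firing =
  near :: "'a set"
  far :: "'a set"
  len :: real
  segs :: "(real \<Rightarrow> 'a) set"

definition is_firing :: "'a::metric_space set \<Rightarrow> 'a \<Rightarrow> 'a firing \<Rightarrow> bool" where
  "is_firing \<Gamma> q f \<longleftrightarrow>
     near f \<subseteq> \<Gamma> \<and> far f \<subseteq> \<Gamma> \<and> near f \<inter> far f = {} \<and>
     closed (near f) \<and> closed (far f) \<and> connected (near f) \<and> connected (far f) \<and>
     q \<in> near f \<and> far f \<noteq> {} \<and> 0 < len f \<and>
     finite (segs f) \<and>
     (\<forall>\<sigma>\<in>segs f. segment_param \<Gamma> (len f) \<sigma> \<and> \<sigma> 0 \<in> near f \<and> \<sigma> (len f) \<in> far f) \<and>
     disjoint_family_on (\<lambda>\<sigma>. \<sigma> ` {0<..<len f}) (segs f) \<and>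
     \<Gamma> - (near f \<union> far f) = (\<Union>\<sigma>\<in>segs f. \<sigma> ` {0<..<len f})"

definition firing_div :: "'a firing \<Rightarrow> 'a divisor" where
  "firing_div f = (\<Sum>\<sigma>\<in>segs f. chip (\<sigma> (len f)) - chip (\<sigma> 0))"

definition legal_firing :: "'a::metric_space set \<Rightarrow> 'a \<Rightarrow> 'a divisor \<Rightarrow> 'a firing \<Rightarrow> bool" where
  "legal_firing \<Gamma> q D f \<longleftrightarrow>
     is_firing \<Gamma> q f \<and> (\<forall>p\<in>\<Gamma>. p \<noteq> q \<longrightarrow> 0 \<le> coeff_at (D - firing_div f) p)"

text \<open>
  The chips that move and their directions are determined by the side \<open>Y\<close> from which they
  are pushed, so prolonging a firing along the same cut means keeping \<open>Y\<close> and shrinking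
  \<open>X\<close>. This is impossible exactly when a chip reaches a point of degree other than 2 or
  \<open>q\<close>, which has to remain in \<open>X\<close>.
\<close>

definition maximal_legal_firing :: "'a::metric_space set \<Rightarrow> 'a \<Rightarrow> 'a divisor \<Rightarrow> 'a firing \<Rightarrow> bool" where
  "maximal_legal_firing \<Gamma> q D f \<longleftrightarrow>
     legal_firing \<Gamma> q D f \<and>
     (\<forall>g. legal_firing \<Gamma> q D g \<and> far g = far f \<longrightarrow> len g \<le> len f)"


section \<open>Ordinals\<close>

text \<open>
  An ordinal is given by an element \<open>\<alpha>\<close> of an arbitrary well-ordered type, namely as the
  order type of the elements below \<open>\<alpha>\<close>.
\<close>

definition ord_zero :: "'o::wellorder" where
  "ord_zero = (LEAST \<beta>. True)"

definition ord_succ :: "'o::wellorder \<Rightarrow> 'o" where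
  "ord_succ \<beta> = (LEAST \<gamma>. \<beta> < \<gamma>)"

definition ord_limit :: "'o::wellorder \<Rightarrow> bool" where
  "ord_limit \<mu> \<longleftrightarrow> (\<exists>\<beta>. \<beta> < \<mu>) \<and> (\<forall>\<beta><\<mu>. \<exists>\<gamma>. \<beta> < \<gamma> \<and> \<gamma> < \<mu>)"

definition ord_type :: "'o::wellorder \<Rightarrow> 'o rel" where
  "ord_type \<alpha> = {(\<beta>, \<gamma>). \<beta> \<le> \<gamma> \<and> \<gamma> < \<alpha>}"

text \<open>
  The ordinal \<open>\<omega>\<close> to the power \<open>n\<close>: sequences of \<open>n\<close> natural numbers in lexicographic order,
  the first entry being the most significant one. Thus the case \<open>Suc n\<close> consists of
  \<open>\<omega>\<close> consecutive copies of the case \<open>n\<close>, and the case \<open>0\<close> has the empty list as only element.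
\<close>

definition omega_power :: "nat \<Rightarrow> nat list rel" where
  "omega_power n = lexn less_than n \<union> Id_on {xs. length xs = n}"

lemma Field_ord_type: "Field (ord_type \<alpha>) = {..<\<alpha>}"
  unfolding ord_type_def Field_def by fastforce

lemma Well_order_ord_type: "Well_order (ord_type \<alpha>)"
proof -
  have "ord_type \<alpha> - Id \<subseteq> {(x, y). x < y}"
    unfolding ord_type_def by auto
  then have "wf (ord_type \<alpha> - Id)"
    using wf wf_subset by blast
  then show ?thesis
    unfolding well_order_on_def linear_order_on_def partial_order_on_def preorder_on_def
      refl_on_def trans_def antisym_def total_on_def Field_ord_type
    by (auto simp: ord_type_def)
qed

lemma Field_omega_power: "Field (omega_power n) = {xs. length xs = n}"
  unfolding omega_power_def Field_def by (auto dest: lexn_length)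

lemma lexn_less_than_Cons:
  assumes "length xs = n" "length ys = n"
  shows "(x # xs, y # ys) \<in> lexn less_than (Suc n) \<longleftrightarrow>
    x < y \<or> x = y \<and> (xs, ys) \<in> lexn less_than n"
proof -
  have "(x # xs, y # ys) = map_prod (\<lambda>(x, xs). x # xs) (\<lambda>(x, xs). x # xs) z
      \<longleftrightarrow> z = ((x, xs), (y, ys))" for z
    by (cases z) auto
  then show ?thesis using assms by (simp add: image_iff)
qed

lemma lexn_less_than_total:
  "length xs = n \<Longrightarrow> length ys = n \<Longrightarrow> xs = ys \<or> (xs, ys) \<in> lexn less_than n \<or> (ys, xs) \<in> lexn less_than n"
proof (induction n arbitrary: xs ys)
  case (Suc n)
  obtain x xs' where xs: "xs = x # xs'" "length xs' = n"
    using Suc.prems(1) by (cases xs) auto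
  obtain y ys' where ys: "ys = y # ys'" "length ys' = n"
    using Suc.prems(2) by (cases ys) auto
  show ?case
    unfolding xs(1) ys(1) lexn_less_than_Cons[OF xs(2) ys(2)] lexn_less_than_Cons[OF ys(2) xs(2)]
    using Suc.IH[OF xs(2) ys(2)] less_linear[of x y] by blast
qed simp

lemma Well_order_omega_power: "Well_order (omega_power n)"
proof -
  have wfl: "wf (lexn less_than n)" by (simp add: wf_lexn)
  then have "wf (omega_power n - Id)"
    by (rule wf_subset) (auto simp: omega_power_def)
  moreover have "trans (lexn less_than n)" by (simp add: lexn_transI)
  then have "trans (omega_power n)"
    unfolding omega_power_def trans_def by blast
  moreover have "antisym (omega_power n)"
    using wf_not_sym[OF wfl] unfolding omega_power_def antisym_def by blast
  moreover have "total_on {xs. length xs = n} (omega_power n)"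
    using lexn_less_than_total unfolding omega_power_def total_on_def by blast
  moreover have "refl_on {xs. length xs = n} (omega_power n)"
    unfolding refl_on_def omega_power_def by (auto dest: lexn_length)
  ultimately show ?thesis
    unfolding well_order_on_def linear_order_on_def partial_order_on_def preorder_on_def
      Field_omega_power
    by (auto simp: omega_power_def dest: lexn_length)
qed


section \<open>Transfinite greedy reductions\<close>

text \<open>
  Convergence of the divisors \<open>Ds \<beta>\<close>, \<open>\<beta> < \<mu>\<close>, to \<open>Ds \<mu>\<close>: after adding \<open>N\<close> chips at \<open>q\<close>
  all of these divisors are sums of \<open>m\<close> chips, labelled in such a way that each one converges.
  The number \<open>m\<close> is forced to be the degree of \<open>Ds \<mu>\<close> plus \<open>N\<close>.
\<close>

definition chips_converge ::
    "'a::metric_space set \<Rightarrow> 'a \<Rightarrow> int \<Rightarrow> ('o::wellorder \<Rightarrow> 'a divisor) \<Rightarrow> 'o \<Rightarrow> bool" where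
  "chips_converge \<Gamma> q N Ds \<mu> \<longleftrightarrow>
     (\<exists>m::nat. \<exists>x :: 'o \<Rightarrow> nat \<Rightarrow> 'a.
        (\<forall>\<beta>\<le>\<mu>. (\<forall>j<m. x \<beta> j \<in> \<Gamma>) \<and>
                 Ds \<beta> + Poly_Mapping.single q N = (\<Sum>j<m. chip (x \<beta> j))) \<and>
        (\<forall>j<m. \<forall>e>0. \<exists>\<beta>\<^sub>0<\<mu>. \<forall>\<beta>. \<beta>\<^sub>0 \<le> \<beta> \<and> \<beta> < \<mu> \<longrightarrow> dist (x \<beta> j) (x \<mu> j) < e))"

definition greedy_reduction ::
    "'a::metric_space set \<Rightarrow> 'a \<Rightarrow> 'a divisor \<Rightarrow> 'o::wellorder \<Rightarrow> ('o \<Rightarrow> 'a divisor) \<Rightarrow> bool" where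
  "greedy_reduction \<Gamma> q D \<alpha> Ds \<longleftrightarrow>
     Ds ord_zero = D \<and>
     (\<forall>\<beta><\<alpha>. \<exists>f. maximal_legal_firing \<Gamma> q (Ds \<beta>) f \<and> Ds (ord_succ \<beta>) = Ds \<beta> - firing_div f) \<and>
     (\<forall>\<mu>\<le>\<alpha>. ord_limit \<mu> \<longrightarrow> chips_converge \<Gamma> q (max 0 (- coeff_at D q)) Ds \<mu>)"

end

theory Submission
  imports Defs
begin

text \<open>
  Let \<open>c \<beta>\<close> be the number of the \<open>m\<close> chips of \<open>D\<^bsub>\<beta>\<^esub> + N (q)\<close> that lie in the finite set
  \<open>V \<union> {q}\<close>. A maximal firing moves a chip into this set, so \<open>c \<ge> 1\<close> at successors.
  The level function of a firing, which is \<open>0\<close> on \<open>X\<close> and \<open>\<epsilon>\<close> on \<open>Y\<close>, is 1-Lipschitz, so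
  \<open>\<epsilon>\<close> is at most the total distance between the labelled chips before and after the firing.
  Hence the lengths tend to \<open>0\<close> as \<open>\<beta>\<close> tends to a limit ordinal \<open>\<mu>\<close>. If all chips that
  converge to a point of \<open>V \<union> {q}\<close> already were at this point, then all other chips would
  be too far away to reach \<open>V \<union> {q}\<close> by such a short firing; so \<open>c \<beta> < c \<mu>\<close> for all
  \<open>\<beta> < \<mu>\<close> close to \<open>\<mu>\<close>. By induction on \<open>k\<close>, an ordinal that is approached by a sequence of
  type \<open>\<omega>\<^sup>k\<close> has \<open>c \<ge> k + 1\<close>, and since \<open>c \<le> m\<close>, the step \<open>\<omega>\<^sup>m\<close> is never reached.
\<close>

section \<open>Interior points of edges\<close>

lemma graph_model_vertices: "graph_model \<Gamma> V n w \<phi> \<Longrightarrow> finite V \<and> V \<subseteq> \<Gamma>"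
  unfolding graph_model_def by (elim conjE) simp

lemma graph_model_dist:
  assumes "graph_model \<Gamma> V n w \<phi>" "x \<in> \<Gamma>" "y \<in> \<Gamma>"
  shows "{L. edge_walk \<Gamma> n w \<phi> x y L} \<noteq> {}" "dist x y = Inf {L. edge_walk \<Gamma> n w \<phi> x y L}"
proof -
  have "\<forall>x\<in>\<Gamma>. \<forall>y\<in>\<Gamma>. (\<exists>L. edge_walk \<Gamma> n w \<phi> x y L) \<and>
      dist x y = Inf {L. edge_walk \<Gamma> n w \<phi> x y L}"
    using assms(1) unfolding graph_model_def by (elim conjE)
  note * = bspec[OF bspec[OF this assms(2)] assms(3)]
  then show "dist x y = Inf {L. edge_walk \<Gamma> n w \<phi> x y L}" by simp
  from * show "{L. edge_walk \<Gamma> n w \<phi> x y L} \<noteq> {}" by simp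
qed

text \<open>The point is not in \<open>V\<close>, so \<open>s\<close> cannot be an end of
  \<open>e'\<close>; disjointness and injectivity of the open edges then decide. The range of
  \<open>s\<close> is closed because walks move along closed edges.\<close>

lemma edge_point_unique:
  assumes M: "graph_model \<Gamma> V n w \<phi>" and e: "e < n" "t \<in> {0<..<w e}"
    and e': "e' < n" "s \<in> {0..w e'}" and eq: "\<phi> e t = \<phi> e' s"
  shows "e' = e \<and> s = t"
proof -
  have edge: "\<And>e. e < n \<Longrightarrow> \<phi> e 0 \<in> V \<and> \<phi> e (w e) \<in> V \<and> inj_on (\<phi> e) {0<..<w e}
      \<and> \<phi> e ` {0<..<w e} \<inter> V = {}"
    using M unfolding graph_model_def by (elim conjE) simp
  have disj: "disjoint_family_on (\<lambda>e. \<phi> e ` {0<..<w e}) {..<n}"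
    using M unfolding graph_model_def by (elim conjE)
  have "\<phi> e t \<notin> V" using edge[OF e(1)] e(2) by blast
  then have "s \<noteq> 0" "s \<noteq> w e'" using edge[OF e'(1)] eq by auto
  then have s: "s \<in> {0<..<w e'}" using e'(2) by auto
  have "\<phi> e t \<in> \<phi> e ` {0<..<w e} \<inter> \<phi> e' ` {0<..<w e'}" using eq s e(2) by (metis IntI imageI)
  then have "e' = e" using disj e(1) e'(1) unfolding disjoint_family_on_def by blast
  moreover have "s = t" using inj_onD[of "\<phi> e" "{0<..<w e}" s t] edge[OF e(1)] s e(2) eq
      \<open>e' = e\<close> by simp
  ultimately show ?thesis by simp
qed

text \<open>A walk leaves an open edge only through one of its ends, so a walk too short for that
  keeps its displacement below its length. Uniqueness of interior points forces every step that
  starts inside \<open>e\<close> to run along \<open>e\<close>.\<close>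

lemma walk_from_edge_point:
  assumes "edge_walk \<Gamma> n w \<phi> x y L" and M: "graph_model \<Gamma> V n w \<phi>"
    and e: "e < n" "t \<in> {0<..<w e}" and "x = \<phi> e t"
  shows "min t (w e - t) \<le> L \<or> (\<exists>s\<in>{0<..<w e}. y = \<phi> e s \<and> \<bar>s - t\<bar> \<le> L)"
  using assms(1,5)
proof (induction rule: edge_walk.induct)
  case (stay x)
  then show ?case using e by auto
next
  case (move x e' s' L s)
  consider "min t (w e - t) \<le> L" | u where "u \<in> {0<..<w e}" "\<phi> e' s' = \<phi> e u" "\<bar>u - t\<bar> \<le> L"
    using move.IH[OF move.prems] by blast
  then show ?case
  proof cases
    case 2
    have "e' = e" "s' = u"
      using edge_point_unique[OF M e(1) 2(1) move.hyps(2,3)] 2(2) by auto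
    then have s: "s \<in> {0..w e}" using move.hyps(4) by simp
    show ?thesis
    proof (cases "s = 0 \<or> s = w e")
      case True
      then have "min t (w e - t) \<le> L + \<bar>u - s\<bar>" using 2(1,3) by auto
      then show ?thesis using \<open>s' = u\<close> by simp
    next
      case False
      moreover have "\<bar>s - t\<bar> \<le> L + \<bar>s' - s\<bar>" using 2(3) \<open>s' = u\<close> by linarith
      ultimately show ?thesis using s \<open>e' = e\<close> by (intro disjI2 bexI[of _ s]) auto
    qed
  qed auto
qed

text \<open>This carries the dichotomy over to the infimum of the lengths. One walk that is too
  short to leave the edge fixes \<open>s\<close>; any other walk to \<open>y\<close> is longer than
  it or ends at the same parameter, so \<bar>s - t\<bar> is a lower bound for all lengths.\<close>

lemma edge_point_neighbourhood:
  assumes M: "graph_model \<Gamma> V n w \<phi>" and e: "e < n" "t \<in> {0<..<w e}"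
    and y: "y \<in> \<Gamma>" "dist (\<phi> e t) y < min t (w e - t)"
  shows "\<exists>s\<in>{0<..<w e}. y = \<phi> e s \<and> \<bar>s - t\<bar> \<le> dist (\<phi> e t) y"
proof -
  let ?W = "{L. edge_walk \<Gamma> n w \<phi> (\<phi> e t) y L}"
  have "\<phi> e t \<in> \<Gamma>" using graph_model_edge_subset[OF M e(1)] e(2) by auto
  then have ne: "?W \<noteq> {}" and d: "dist (\<phi> e t) y = Inf ?W"
    using graph_model_dist[OF M] y(1) by auto
  obtain L where L: "L \<in> ?W" "L < min t (w e - t)"
    using cInf_lessD[OF ne] y(2) d by metis
  then have "edge_walk \<Gamma> n w \<phi> (\<phi> e t) y L" "\<not> min t (w e - t) \<le> L"
    by (simp_all only: mem_Collect_eq not_le)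
  then obtain s where s: "s \<in> {0<..<w e}" "y = \<phi> e s" "\<bar>s - t\<bar> \<le> L"
    using walk_from_edge_point[OF _ M e refl, of y L] by blast
  have "\<bar>s - t\<bar> \<le> L'" if L': "L' \<in> ?W" for L'
  proof -
    have "edge_walk \<Gamma> n w \<phi> (\<phi> e t) y L'" using L' by simp
    note walk_from_edge_point[OF this M e refl]
    then show ?thesis
    proof (elim disjE bexE conjE)
      assume "min t (w e - t) \<le> L'"
      then show ?thesis using s(3) L(2) by linarith
    next
      fix u assume u: "u \<in> {0<..<w e}" "y = \<phi> e u" "\<bar>u - t\<bar> \<le> L'"
      have "u = s" using edge_point_unique[OF M e(1) s(1) e(1), of u] s(2) u(1,2) by simp
      with u(3) show ?thesis by simp
    qed
  qed
  then have "\<bar>s - t\<bar> \<le> dist (\<phi> e t) y"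
    unfolding d by (rule cInf_greatest[OF ne])
  then show ?thesis using s by blast
qed

lemma edge_point_chart:
  assumes M: "graph_model \<Gamma> V n w \<phi>" and e: "e < n" "t \<in> {0<..<w e}"
  obtains R where "R > 0"
    "\<And>u v. \<bar>u\<bar> < R \<Longrightarrow> \<bar>v\<bar> < R \<Longrightarrow> dist (\<phi> e (t + u)) (\<phi> e (t + v)) = \<bar>u - v\<bar>"
    "\<And>u. \<bar>u\<bar> < R \<Longrightarrow> \<phi> e (t + u) \<in> \<Gamma>"
    "\<And>y. y \<in> \<Gamma> \<Longrightarrow> dist (\<phi> e t) y < R \<Longrightarrow> \<exists>u. \<bar>u\<bar> < R \<and> y = \<phi> e (t + u)"
proof -
  \<comment> \<open>A third leaves room: two points within \<open>R\<close> of the centre are less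
    than \<open>2 * R\<close> apart, while each is more than \<open>2 * R\<close> away from the ends
    of the edge, so either can serve as the centre of a neighbourhood.\<close>
  define R where "R = min t (w e - t) / 3"
  have R0: "0 < R" and R_t: "3 * R \<le> t" "3 * R \<le> w e - t" and R_min: "3 * R = min t (w e - t)"
    using e(2) by (simp_all add: R_def)
  have inside: "t + u \<in> {0<..<w e}" "2 * R < min (t + u) (w e - (t + u))" if "\<bar>u\<bar> < R" for u
    using that R0 R_t by auto
  show thesis
  proof (rule that[OF R0])
    show "dist (\<phi> e (t + u)) (\<phi> e (t + v)) = \<bar>u - v\<bar>" if uv: "\<bar>u\<bar> < R" "\<bar>v\<bar> < R" for u v
    proof (rule antisym)
      have le: "dist (\<phi> e (t + u)) (\<phi> e (t + v)) \<le> \<bar>(t + u) - (t + v)\<bar>"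
        using graph_model_edge_dist[OF M e(1), of "t + u" "t + v"] inside(1)[OF uv(1)] inside(1)[OF uv(2)] by simp
      then show "dist (\<phi> e (t + u)) (\<phi> e (t + v)) \<le> \<bar>u - v\<bar>" by simp
      have "\<phi> e (t + v) \<in> \<Gamma>"
        using graph_model_edge_subset[OF M e(1)] inside(1)[OF uv(2)] by auto
      moreover have "dist (\<phi> e (t + u)) (\<phi> e (t + v)) < min (t + u) (w e - (t + u))"
        using uv le inside(2)[OF uv(1)] by linarith
      ultimately obtain s where s: "s \<in> {0<..<w e}" "\<phi> e (t + v) = \<phi> e s"
          "\<bar>s - (t + u)\<bar> \<le> dist (\<phi> e (t + u)) (\<phi> e (t + v))"
        using edge_point_neighbourhood[OF M e(1) inside(1)[OF uv(1)]] by blast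
      have "t + v = s"
        using edge_point_unique[OF M e(1) s(1) e(1), of "t + v"] inside(1)[OF uv(2)] s(2) by auto
      then show "\<bar>u - v\<bar> \<le> dist (\<phi> e (t + u)) (\<phi> e (t + v))" using s(3) by simp
    qed
    show "\<phi> e (t + u) \<in> \<Gamma>" if "\<bar>u\<bar> < R" for u
      using graph_model_edge_subset[OF M e(1)] inside(1)[OF that] by auto
    show "\<exists>u. \<bar>u\<bar> < R \<and> y = \<phi> e (t + u)" if y: "y \<in> \<Gamma>" "dist (\<phi> e t) y < R" for y
    proof -
      have "dist (\<phi> e t) y < min t (w e - t)" using y(2) R0 R_min by linarith
      then obtain s where "y = \<phi> e s" "\<bar>s - t\<bar> \<le> dist (\<phi> e t) y"
        using edge_point_neighbourhood[OF M e y(1)] by blast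
      then show ?thesis using y(2) by (intro exI[of _ "s - t"]) auto
    qed
  qed
qed

text \<open>The metric of \<open>\<Gamma>\<close> is a length metric, so Lipschitz bounds may be checked locally.\<close>

lemma lipschitz_if_locally:
  fixes g :: "'a::metric_space \<Rightarrow> real"
  assumes M: "graph_model \<Gamma> V n w \<phi>"
    and loc: "\<And>p. p \<in> \<Gamma> \<Longrightarrow> \<exists>d>0. \<forall>p'\<in>\<Gamma>. dist p p' < d \<longrightarrow> \<bar>g p - g p'\<bar> \<le> dist p p'"
    and ab: "a \<in> \<Gamma>" "b \<in> \<Gamma>"
  shows "\<bar>g a - g b\<bar> \<le> dist a b"
proof -
  have edge: "\<bar>g (\<phi> e s) - g (\<phi> e t)\<bar> \<le> \<bar>s - t\<bar>"
    if e: "e < n" and st: "s \<in> {0..w e}" "t \<in> {0..w e}" for e s t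
  proof -
    \<comment> \<open>\<open>?P\<close> is inherited by concatenated intervals and holds on short
      intervals around each point, as the bisection principle \<open>Bolzano\<close> requires. The
      guard sits inside \<open>?P\<close> because those short intervals may stick out of the
      edge.\<close>
    let ?P = "\<lambda>s t. 0 \<le> s \<and> t \<le> w e \<longrightarrow> \<bar>g (\<phi> e s) - g (\<phi> e t)\<bar> \<le> t - s"
    have *: "?P s t" if "s \<le> t" "0 \<le> s" "t \<le> w e" for s t
      using that(1)
    proof (rule Bolzano[where P = ?P])
      show "?P a c" if "?P a b" "?P b c" "a \<le> b" "b \<le> c" for a b c
        using that by auto
      fix x assume x: "s \<le> x" "x \<le> t"
      with that have x': "x \<in> {0..w e}" by auto
      then obtain d where d: "d > 0"
          "\<And>p'. p' \<in> \<Gamma> \<Longrightarrow> dist (\<phi> e x) p' < d \<Longrightarrow> \<bar>g (\<phi> e x) - g p'\<bar> \<le> dist (\<phi> e x) p'"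
        using loc[of "\<phi> e x"] graph_model_edge_subset[OF M e] by blast
      have near_x: "\<bar>g (\<phi> e x) - g (\<phi> e y)\<bar> \<le> \<bar>x - y\<bar>" if "y \<in> {0..w e}" "\<bar>x - y\<bar> < d" for y
      proof -
        have "dist (\<phi> e x) (\<phi> e y) \<le> \<bar>x - y\<bar>"
          by (rule graph_model_edge_dist[OF M e x' that(1)])
        moreover have "\<phi> e y \<in> \<Gamma>" using graph_model_edge_subset[OF M e] that(1) by blast
        ultimately show ?thesis using d(2)[of "\<phi> e y"] that(2) by linarith
      qed
      show "\<exists>d>0. \<forall>a b. a \<le> x \<and> x \<le> b \<and> b - a < d \<longrightarrow> ?P a b"
      proof (intro exI[of _ d] conjI allI impI d(1))
        fix a b assume "a \<le> x \<and> x \<le> b \<and> b - a < d" "0 \<le> a \<and> b \<le> w e"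
        then show "\<bar>g (\<phi> e a) - g (\<phi> e b)\<bar> \<le> b - a"
          using near_x[of a] near_x[of b] x' by auto
      qed
    qed
    show ?thesis using *[of s t] *[of t s] st by (cases "s \<le> t") auto
  qed
  have walk: "\<bar>g x - g y\<bar> \<le> L" if "edge_walk \<Gamma> n w \<phi> x y L" for x y L
    using that
  proof induction
    case (move x e s L t)
    then show ?case using edge[OF move.hyps(2-4)] by linarith
  qed simp
  let ?W = "{L. edge_walk \<Gamma> n w \<phi> a b L}"
  have "?W \<noteq> {}" "dist a b = Inf ?W"
    using graph_model_dist[OF M ab] by auto
  then show ?thesis using walk by (auto intro!: cInf_greatest)
qed

section \<open>The level function of a firing\<close>

locale model_firing =
  fixes \<Gamma> :: "'a::metric_space set" and V n w \<phi> and q :: 'a and f :: "'a firing"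
  assumes model: "graph_model \<Gamma> V n w \<phi>"
    and firing: "is_firing \<Gamma> q f"
begin

lemma near_far: "near f \<subseteq> \<Gamma>" "far f \<subseteq> \<Gamma>" "near f \<inter> far f = {}" "closed (near f)" "closed (far f)"
    "connected (near f)" "q \<in> near f" "0 < len f" "finite (segs f)"
  using firing unfolding is_firing_def by simp_all

lemma seg:
  assumes "\<sigma> \<in> segs f"
  shows "\<sigma> 0 \<in> near f" "\<sigma> (len f) \<in> far f" "\<sigma> ` {0..len f} \<subseteq> \<Gamma>" "continuous_on {0..len f} \<sigma>"
    "inj_on \<sigma> {0<..<len f}"
    "\<And>t. t \<in> {0<..<len f} \<Longrightarrow> \<exists>\<delta>>0. \<forall>s\<in>{0<..<len f}. \<forall>u\<in>{0<..<len f}.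
        \<bar>s - t\<bar> < \<delta> \<longrightarrow> \<bar>u - t\<bar> < \<delta> \<longrightarrow> dist (\<sigma> s) (\<sigma> u) = \<bar>s - u\<bar>"
  using firing assms unfolding is_firing_def segment_param_def by simp_all

lemma middle: "\<Gamma> - (near f \<union> far f) = (\<Union>\<sigma>\<in>segs f. \<sigma> ` {0<..<len f})"
  using firing unfolding is_firing_def by simp

lemma seg_in_middle:
  assumes "\<sigma> \<in> segs f" "t \<in> {0<..<len f}"
  shows "\<sigma> t \<in> \<Gamma>" "\<sigma> t \<notin> near f" "\<sigma> t \<notin> far f"
proof -
  have "\<sigma> t \<in> \<Gamma> - (near f \<union> far f)" using assms unfolding middle by blast
  then show "\<sigma> t \<in> \<Gamma>" "\<sigma> t \<notin> near f" "\<sigma> t \<notin> far f" by simp_all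
qed

lemma seg_eq:
  assumes "\<sigma> \<in> segs f" "\<tau> \<in> segs f" "s \<in> {0<..<len f}" "t \<in> {0<..<len f}" "\<sigma> s = \<tau> t"
  shows "\<sigma> = \<tau>" "s = t"
proof -
  have disj: "disjoint_family_on (\<lambda>\<sigma>. \<sigma> ` {0<..<len f}) (segs f)"
    using firing unfolding is_firing_def by simp
  have "\<sigma> s \<in> \<sigma> ` {0<..<len f} \<inter> \<tau> ` {0<..<len f}"
    using assms(3-5) by (metis IntI imageI)
  then show "\<sigma> = \<tau>" using disj assms(1,2) unfolding disjoint_family_on_def by blast
  then show "s = t" using inj_onD[OF seg(5)[OF assms(1)]] assms by simp
qed

text \<open>This is the piecewise affine function associated with the firing. Off
  \<open>near f\<close> and \<open>far f\<close> the parameter exists and is unique, since the open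
  segments cover the rest of \<Gamma>, are disjoint and are injectively parametrized.\<close>

definition level :: "'a \<Rightarrow> real" where
  "level p = (if p \<in> near f then 0 else if p \<in> far f then len f
     else (THE t. t \<in> {0<..<len f} \<and> (\<exists>\<sigma>\<in>segs f. p = \<sigma> t)))"

lemma level_near [simp]: "p \<in> near f \<Longrightarrow> level p = 0"
  by (simp add: level_def)

lemma level_far [simp]: "p \<in> far f \<Longrightarrow> level p = len f"
  using near_far(3) by (auto simp: level_def)

lemma level_seg:
  assumes "\<sigma> \<in> segs f" "t \<in> {0..len f}"
  shows "level (\<sigma> t) = t"
proof -
  consider "t = 0" | "t = len f" | "t \<in> {0<..<len f}" using assms(2) by fastforce
  then show ?thesis
  proof cases
    case 3
    have "(THE s. s \<in> {0<..<len f} \<and> (\<exists>\<tau>\<in>segs f. \<sigma> t = \<tau> s)) = t"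
    proof (rule the_equality)
      show "t \<in> {0<..<len f} \<and> (\<exists>\<tau>\<in>segs f. \<sigma> t = \<tau> t)" using 3 assms(1) by blast
      show "s = t" if "s \<in> {0<..<len f} \<and> (\<exists>\<tau>\<in>segs f. \<sigma> t = \<tau> s)" for s
        using that seg_eq(2)[OF assms(1)] 3 by metis
    qed
    then show ?thesis using seg_in_middle[OF assms(1) 3] by (simp add: level_def)
  qed (use seg[OF assms(1)] in simp_all)
qed

lemma point_cases:
  assumes "p \<in> \<Gamma>"
  obtains "p \<in> near f" | "p \<in> far f" | \<sigma> t where "\<sigma> \<in> segs f" "t \<in> {0<..<len f}" "p = \<sigma> t"
  using assms middle by blast

lemma level_range: "p \<in> \<Gamma> \<Longrightarrow> level p \<in> {0..len f}"
  by (erule point_cases) (use near_far(8) in \<open>auto simp: level_seg\<close>)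

text \<open>The preimage of a closed set is a finite union of closed pieces: \<open>near f\<close>,
  \<open>far f\<close> and images of compact parts of the segments. The argument is topological, so
  it covers the ends of the segments too.\<close>

lemma continuous_level: "continuous_on \<Gamma> level"
proof -
  have closed: "closed \<Gamma>"
    using metric_graph_compact model unfolding metric_graph_def by (blast intro: compact_imp_closed)
  show ?thesis
    unfolding continuous_on_closed_vimage[OF closed]
  proof (intro allI impI)
    fix C :: "real set" assume C: "closed C"
    have "level -` C \<inter> \<Gamma> = (if 0 \<in> C then near f else {}) \<union> (if len f \<in> C then far f else {})
        \<union> (\<Union>\<sigma>\<in>segs f. \<sigma> ` (C \<inter> {0..len f}))" (is "?L = ?R")
    proof (rule set_eqI)
      fix p
      show "p \<in> ?L \<longleftrightarrow> p \<in> ?R"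
      proof
        assume p: "p \<in> ?L"
        then have "p \<in> \<Gamma>" by simp
        then show "p \<in> ?R"
        proof (cases rule: point_cases)
          case (3 \<sigma> t)
          then have "t \<in> C \<inter> {0..len f}" using p level_seg[of \<sigma> t] by auto
          then show ?thesis using 3 by blast
        qed (use p in auto)
      next
        assume p: "p \<in> ?R"
        then have "(0 \<in> C \<and> p \<in> near f) \<or> (len f \<in> C \<and> p \<in> far f)
            \<or> (\<exists>\<sigma>\<in>segs f. \<exists>t\<in>C \<inter> {0..len f}. p = \<sigma> t)"
          by (auto split: if_splits)
        then show "p \<in> ?L"
        proof (elim disjE bexE conjE)
          fix \<sigma> t assume "\<sigma> \<in> segs f" "t \<in> C \<inter> {0..len f}" "p = \<sigma> t"
          then show ?thesis using level_seg[of \<sigma> t] seg(3)[of \<sigma>] by auto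
        qed (use near_far(1,2) in auto)
      qed
    qed
    moreover have "closed (\<sigma> ` (C \<inter> {0..len f}))" if "\<sigma> \<in> segs f" for \<sigma>
    proof (intro compact_imp_closed compact_continuous_image)
      show "continuous_on (C \<inter> {0..len f}) \<sigma>"
        using seg(4)[OF that] by (rule continuous_on_subset) simp
      show "compact (C \<inter> {0..len f})"
        by (rule closed_Int_compact[OF C]) simp
    qed
    ultimately show "closed (level -` C \<inter> \<Gamma>)"
      using near_far(4,5,9) by (auto intro!: closed_Un closed_UN)
  qed
qed

text \<open>Bisection turns the local isometry into a global upper bound on the open segment, and
  continuity extends the bound to the two ends.\<close>

lemma seg_nonexpansive:
  assumes \<sigma>: "\<sigma> \<in> segs f" and st: "s \<in> {0..len f}" "t \<in> {0..len f}"
  shows "dist (\<sigma> s) (\<sigma> t) \<le> \<bar>s - t\<bar>"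
proof -
  have le: "dist (\<sigma> s) (\<sigma> t) \<le> t - s" if "s \<le> t" "0 < s" "t < len f" for s t
  proof -
    let ?P = "\<lambda>a b. 0 < a \<and> b < len f \<longrightarrow> dist (\<sigma> a) (\<sigma> b) \<le> b - a"
    have "?P s t"
      using that(1)
    proof (rule Bolzano[where P = ?P])
      fix a b c assume *: "?P a b" "?P b c" "a \<le> b" "b \<le> c"
      show "?P a c"
      proof
        assume "0 < a \<and> c < len f"
        then have "dist (\<sigma> a) (\<sigma> b) \<le> b - a" "dist (\<sigma> b) (\<sigma> c) \<le> c - b" using * by auto
        then show "dist (\<sigma> a) (\<sigma> c) \<le> c - a" using dist_triangle[of "\<sigma> a" "\<sigma> c" "\<sigma> b"] by linarith
      qed
    next
      fix x assume "s \<le> x" "x \<le> t"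
      then have "x \<in> {0<..<len f}" using that by auto
      then obtain d where d: "d > 0" "\<forall>s\<in>{0<..<len f}. \<forall>u\<in>{0<..<len f}.
          \<bar>s - x\<bar> < d \<longrightarrow> \<bar>u - x\<bar> < d \<longrightarrow> dist (\<sigma> s) (\<sigma> u) = \<bar>s - u\<bar>"
        using seg(6)[OF \<sigma>] by meson
      show "\<exists>d>0. \<forall>a b. a \<le> x \<and> x \<le> b \<and> b - a < d \<longrightarrow> ?P a b"
      proof (intro exI[of _ d] conjI allI impI d(1))
        fix a b assume "a \<le> x \<and> x \<le> b \<and> b - a < d" "0 < a \<and> b < len f"
        then show "dist (\<sigma> a) (\<sigma> b) \<le> b - a" using d(2)[rule_format, of a b] by auto
      qed
    qed
    then show ?thesis using that by simp
  qed
  have "1-lipschitz_on {0<..<len f} \<sigma>"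
  proof (rule lipschitz_onI)
    fix s t assume "s \<in> {0<..<len f}" "t \<in> {0<..<len f}"
    then show "dist (\<sigma> s) (\<sigma> t) \<le> 1 * dist s t"
      using le[of s t] le[of t s] by (cases "s \<le> t") (auto simp: dist_real_def dist_commute)
  qed simp
  then have "1-lipschitz_on {0..len f} \<sigma>"
    using lipschitz_on_closure[of 1 "{0<..<len f}" \<sigma>] seg(4)[OF \<sigma>] near_far(8) by simp
  from lipschitz_onD[OF this st] show ?thesis by (simp add: dist_real_def)
qed

text \<open>Close to a point inside a segment, \<Gamma> consists of that segment alone: the closed
  set \<open>K\<close> of everything else misses the point. There \<open>level\<close> is the
  inverse of a local isometry.\<close>

lemma level_local:
  assumes p: "p \<in> \<Gamma>" "0 < level p" "level p < len f"
  shows "\<exists>d>0. \<forall>p'\<in>\<Gamma>. dist p p' < d \<longrightarrow> \<bar>level p - level p'\<bar> = dist p p'"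
proof -
  from p(1) obtain \<sigma> s where \<sigma>: "\<sigma> \<in> segs f" "s \<in> {0<..<len f}" "p = \<sigma> s"
    by (cases rule: point_cases) (use p in auto)
  obtain d1 where d1: "d1 > 0" "\<And>u v. u \<in> {0<..<len f} \<Longrightarrow> v \<in> {0<..<len f} \<Longrightarrow>
      \<bar>u - s\<bar> < d1 \<Longrightarrow> \<bar>v - s\<bar> < d1 \<Longrightarrow> dist (\<sigma> u) (\<sigma> v) = \<bar>u - v\<bar>"
    using seg(6)[OF \<sigma>(1,2)] by meson
  define K where "K = near f \<union> far f \<union> (\<Union>\<tau>\<in>segs f - {\<sigma>}. \<tau> ` {0..len f})"
  have "closed (\<tau> ` {0..len f})" if "\<tau> \<in> segs f" for \<tau>
    using seg(4)[OF that] by (intro compact_imp_closed compact_continuous_image) auto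
  then have "closed K"
    unfolding K_def using near_far(4,5,9) by (intro closed_Un closed_UN) auto
  moreover have "p \<notin> K"
  proof
    assume "p \<in> K"
    then consider "p \<in> near f \<union> far f" | \<tau> t where "\<tau> \<in> segs f" "\<tau> \<noteq> \<sigma>" "t \<in> {0..len f}" "p = \<tau> t"
      unfolding K_def by blast
    then show False
    proof cases
      case 2
      then have "t = s" using level_seg \<sigma> by (metis greaterThanLessThan_subseteq_atLeastAtMost_iff order_refl subsetD)
      then show False using seg_eq(1)[OF 2(1) \<sigma>(1), of s s] 2 \<sigma> by simp
    qed (use seg_in_middle[OF \<sigma>(1,2)] \<sigma>(3) in auto)
  qed
  ultimately obtain d2 where d2: "d2 > 0" "ball p d2 \<subseteq> - K"
    using open_contains_ball[of "- K"] by (auto simp: open_Compl)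
  \<comment> \<open>Continuity of \<open>level\<close> converts closeness of points into closeness
    of parameters.\<close>
  obtain d3 where d3: "d3 > 0" "\<And>p'. p' \<in> \<Gamma> \<Longrightarrow> dist p' p < d3 \<Longrightarrow> dist (level p') (level p) < d1"
    using continuous_level p(1) d1(1) unfolding continuous_on_iff by blast
  show ?thesis
  proof (intro exI[of _ "min d2 d3"] conjI ballI impI)
    fix p' assume p': "p' \<in> \<Gamma>" "dist p p' < min d2 d3"
    then have "p' \<notin> K" using d2(2) by (auto simp: mem_ball)
    from p'(1) obtain t where t: "t \<in> {0<..<len f}" "p' = \<sigma> t"
    proof (cases rule: point_cases)
      case (3 \<tau> t)
      then show thesis using that[of t] \<open>p' \<notin> K\<close> unfolding K_def by fastforce
    qed (use \<open>p' \<notin> K\<close> in \<open>auto simp: K_def\<close>)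
    have lev: "level p' = t" "level p = s"
      using level_seg[OF \<sigma>(1)] t \<sigma> by auto
    have "\<bar>t - s\<bar> < d1" using d3(2)[OF p'(1)] p'(2) unfolding lev by (simp add: dist_commute dist_real_def)
    then show "\<bar>level p - level p'\<bar> = dist p p'"
      using d1(2)[OF \<sigma>(2) t(1)] d1(1) unfolding lev unfolding t(2) \<sigma>(3) by simp
  qed (use d2 d3 in simp)
qed

text \<open>The definition of a segment gives no metric control at its ends; clamping the level
  function to \<open>{\<eta>..len f - \<eta>}\<close> makes it locally constant there.\<close>

lemma level_lipschitz:
  assumes ab: "a \<in> \<Gamma>" "b \<in> \<Gamma>"
  shows "\<bar>level a - level b\<bar> \<le> dist a b"
proof (rule field_le_epsilon)
  fix e :: real assume "0 < e"
  \<comment> \<open>Clamping changes each of the two values by at most \<eta>, so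
    \<open>e / 2\<close> keeps the total error below \<open>e\<close>; \<open>len f / 3\<close>
    keeps the clamping interval nondegenerate.\<close>
  define \<eta> where "\<eta> = min (e / 2) (len f / 3)"
  have \<eta>: "0 < \<eta>" "2 * \<eta> \<le> e" "\<eta> < len f - \<eta>"
    using \<open>0 < e\<close> near_far(8) by (auto simp: \<eta>_def min_def)
  define g where "g p = max \<eta> (min (len f - \<eta>) (level p))" for p
  have g_level: "\<bar>g x - g y\<bar> \<le> \<bar>level x - level y\<bar>" for x y
    unfolding g_def by (auto simp: min_def max_def)
  have g_near: "\<bar>g x - level x\<bar> \<le> \<eta>" if "x \<in> \<Gamma>" for x
    using level_range[OF that] \<eta> unfolding g_def by (auto simp: min_def max_def)
  have "\<bar>g a - g b\<bar> \<le> dist a b"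
  proof (rule lipschitz_if_locally[OF model _ ab])
    fix p assume p: "p \<in> \<Gamma>"
    have flat: "\<exists>d>0. \<forall>p'\<in>\<Gamma>. dist p p' < d \<longrightarrow> \<bar>g p - g p'\<bar> \<le> dist p p'"
      if "level p = 0 \<or> level p = len f"
    proof -
      obtain d where d: "d > 0" "\<And>p'. p' \<in> \<Gamma> \<Longrightarrow> dist p' p < d \<Longrightarrow> dist (level p') (level p) < \<eta>"
        using continuous_level p \<eta>(1) unfolding continuous_on_iff by blast
      have "g p' = g p" if "p' \<in> \<Gamma>" "dist p p' < d" for p'
        using d(2)[of p'] that \<open>level p = 0 \<or> level p = len f\<close> \<eta> unfolding g_def
        by (auto simp: min_def max_def dist_real_def dist_commute)
      then show ?thesis using d(1) by (intro exI[of _ d]) auto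
    qed
    show "\<exists>d>0. \<forall>p'\<in>\<Gamma>. dist p p' < d \<longrightarrow> \<bar>g p - g p'\<bar> \<le> dist p p'"
    proof (cases "level p = 0 \<or> level p = len f")
      case False
      then have "0 < level p" "level p < len f" using level_range[OF p] by auto
      from level_local[OF p this] obtain d where
        d: "d > 0" "\<And>p'. p' \<in> \<Gamma> \<Longrightarrow> dist p p' < d \<Longrightarrow> \<bar>level p - level p'\<bar> = dist p p'" by blast
      have "\<bar>g p - g p'\<bar> \<le> dist p p'" if "p' \<in> \<Gamma>" "dist p p' < d" for p'
        using d(2)[OF that] g_level[of p p'] by linarith
      then show ?thesis using d(1) by blast
    qed (rule flat)
  qed
  then show "\<bar>level a - level b\<bar> \<le> dist a b + e"
    using g_near[OF ab(1)] g_near[OF ab(2)] \<eta>(2) by linarith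
qed

text \<open>The lower bound comes from \<open>level\<close>, which is 1-Lipschitz and recovers the
  parameter. A segment of the cut is thus a shortest path between any two of its points, although a
  general \<open>segment_param\<close> is isometric only locally.\<close>

lemma seg_isometric:
  assumes \<sigma>: "\<sigma> \<in> segs f" and st: "s \<in> {0..len f}" "t \<in> {0..len f}"
  shows "dist (\<sigma> s) (\<sigma> t) = \<bar>s - t\<bar>"
proof (rule antisym)
  have "\<sigma> s \<in> \<Gamma>" "\<sigma> t \<in> \<Gamma>" using seg(3)[OF \<sigma>] st by auto
  from level_lipschitz[OF this] show "\<bar>s - t\<bar> \<le> dist (\<sigma> s) (\<sigma> t)"
    using level_seg[OF \<sigma>] st by simp
qed (rule seg_nonexpansive[OF assms])

end

section \<open>Prolonging a firing\<close>

text \<open>In a separation of \<open>A\<close>, one part misses the only possible common point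
  \<open>z\<close>. That part is disjoint from \<open>B\<close>, so it also splits off from the
  connected union.\<close>

lemma connected_closed_part:
  assumes "connected (A \<union> B)" "closed A" "closed B" "A \<inter> B \<subseteq> {z}"
  shows "connected A"
  unfolding connected_closed
proof
  assume "\<exists>S T. closed S \<and> closed T \<and> A \<subseteq> S \<union> T \<and> S \<inter> T \<inter> A = {} \<and> S \<inter> A \<noteq> {} \<and> T \<inter> A \<noteq> {}"
  then obtain S T where ST: "closed S" "closed T" "A \<subseteq> S \<union> T" "S \<inter> T \<inter> A = {}" "S \<inter> A \<noteq> {}" "T \<inter> A \<noteq> {}"
    by blast
  \<comment> \<open>Here \<open>T\<close> is the part that misses \<open>z\<close>; the other case
    exchanges \<open>S\<close> and \<open>T\<close>.\<close>
  have no: False if "closed S" "closed T" "A \<subseteq> S \<union> T" "S \<inter> T \<inter> A = {}" "S \<inter> A \<noteq> {}" "T \<inter> A \<noteq> {}"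
    "z \<notin> T \<inter> A" for S T
  proof -
    have "closed (S \<inter> A \<union> B)" "closed (T \<inter> A)" using that assms by auto
    moreover have "A \<union> B \<subseteq> (S \<inter> A \<union> B) \<union> (T \<inter> A)" "(S \<inter> A \<union> B) \<inter> (T \<inter> A) \<inter> (A \<union> B) = {}"
      "(S \<inter> A \<union> B) \<inter> (A \<union> B) \<noteq> {}" "(T \<inter> A) \<inter> (A \<union> B) \<noteq> {}"
      using that assms(4) by blast+
    ultimately show False using assms(1) unfolding connected_closed by blast
  qed
  show False
  proof (cases "z \<in> T \<inter> A")
    case False
    then show False using no[of S T] ST by blast
  next
    case True
    then have "z \<notin> S \<inter> A" using ST(4) by blast
    then show False using no[of T S] ST by blast
  qed
qed

text \<open>The balls are removed one at a time. What remains outside a ball and what lies in its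
  closed ball are closed sets that meet only on the sphere, hence in at most one point.\<close>

lemma connected_minus_balls:
  fixes X :: "'a::metric_space set"
  assumes "finite I" "connected X" "closed X" "\<And>i. i \<in> I \<Longrightarrow> X \<inter> sphere (p i) r \<subseteq> {z i}"
  shows "connected (X - (\<Union>i\<in>I. ball (p i) r))"
  using assms(1,4)
proof (induction I rule: finite_induct)
  case (insert i I)
  let ?X = "X - (\<Union>i\<in>I. ball (p i) r)"
  have "connected (?X - ball (p i) r)"
  proof (rule connected_closed_part[of _ "?X \<inter> cball (p i) r" "z i"])
    have "?X = (?X - ball (p i) r) \<union> (?X \<inter> cball (p i) r)" by auto
    then show "connected ((?X - ball (p i) r) \<union> (?X \<inter> cball (p i) r))"
      using insert by simp
    have "closed ?X" using assms(3) by (intro closed_Diff open_UN) auto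
    then show "closed (?X - ball (p i) r)" "closed (?X \<inter> cball (p i) r)" by auto
    show "(?X - ball (p i) r) \<inter> (?X \<inter> cball (p i) r) \<subseteq> {z i}"
      using insert.prems[of i] by fastforce
  qed
  moreover have "?X - ball (p i) r = X - (\<Union>i\<in>insert i I. ball (p i) r)" by blast
  ultimately show ?case by simp
qed (use assms(2) in simp)

lemma finite_positive_bound:
  fixes S :: "real set"
  assumes "finite S" "\<And>x. x \<in> S \<Longrightarrow> 0 < x"
  obtains \<eta> where "0 < \<eta>" "\<And>x. x \<in> S \<Longrightarrow> 2 * \<eta> < x"
proof
  \<comment> \<open>The extra element 1 makes the minimum meaningful when \<open>S\<close> is
    empty.\<close>
  let ?m = "Min (insert 1 S)"
  have pos: "0 < ?m" using assms by simp
  then show "0 < ?m / 4" by simp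
  show "2 * (?m / 4) < x" if "x \<in> S" for x
  proof -
    have "?m \<le> x" by (rule Min_le) (use assms(1) that in auto)
    with pos show ?thesis by linarith
  qed
qed

section \<open>Growing the segments of a firing backwards into its near side\<close>

context model_firing
begin

text \<open>The map \<open>c\<close> is an arc length coordinate of \<Gamma> around the near end of
  the segment: positive values run into the segment, negative ones into \<open>near f\<close>. The
  bound by the distance to \<open>q\<close> keeps \<open>q\<close> out of the open ball of radius
  \<open>R\<close>.\<close>

definition chart :: "(real \<Rightarrow> 'a) \<Rightarrow> real \<Rightarrow> (real \<Rightarrow> 'a) \<Rightarrow> bool" where
  "chart \<sigma> R c \<longleftrightarrow> 0 < R \<and> R \<le> len f \<and> R \<le> dist (\<sigma> 0) q \<and>
     (\<forall>u v. \<bar>u\<bar> < R \<longrightarrow> \<bar>v\<bar> < R \<longrightarrow> dist (c u) (c v) = \<bar>u - v\<bar>) \<and>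
     (\<forall>u. \<bar>u\<bar> < R \<longrightarrow> c u \<in> \<Gamma>) \<and>
     (\<forall>y\<in>\<Gamma>. dist (\<sigma> 0) y < R \<longrightarrow> (\<exists>u. \<bar>u\<bar> < R \<and> y = c u)) \<and>
     (\<forall>u. 0 \<le> u \<and> u < R \<longrightarrow> c u = \<sigma> u) \<and>
     (\<forall>u. - R < u \<and> u \<le> 0 \<longrightarrow> c u \<in> near f)"

text \<open>The covering clause is sharpened: as \<open>c\<close> is isometric and starts at
  \<open>\<sigma> 0\<close>, the coordinate of a point has its distance from
  \<open>\<sigma> 0\<close> as absolute value.\<close>

lemma chartD:
  assumes "chart \<sigma> R c"
  shows "0 < R" "R \<le> len f" "R \<le> dist (\<sigma> 0) q"
    "\<And>u v. \<bar>u\<bar> < R \<Longrightarrow> \<bar>v\<bar> < R \<Longrightarrow> dist (c u) (c v) = \<bar>u - v\<bar>"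
    "\<And>u. \<bar>u\<bar> < R \<Longrightarrow> c u \<in> \<Gamma>"
    "\<And>y. y \<in> \<Gamma> \<Longrightarrow> dist (\<sigma> 0) y < R \<Longrightarrow> \<exists>u. \<bar>u\<bar> = dist (\<sigma> 0) y \<and> y = c u"
    "\<And>u. 0 \<le> u \<Longrightarrow> u < R \<Longrightarrow> c u = \<sigma> u"
    "\<And>u. - R < u \<Longrightarrow> u \<le> 0 \<Longrightarrow> c u \<in> near f"
proof -
  show "0 < R" "R \<le> len f" "R \<le> dist (\<sigma> 0) q"
    and iso: "\<And>u v. \<bar>u\<bar> < R \<Longrightarrow> \<bar>v\<bar> < R \<Longrightarrow> dist (c u) (c v) = \<bar>u - v\<bar>"
    and "\<And>u. \<bar>u\<bar> < R \<Longrightarrow> c u \<in> \<Gamma>"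
    and c0: "\<And>u. 0 \<le> u \<Longrightarrow> u < R \<Longrightarrow> c u = \<sigma> u"
    and "\<And>u. - R < u \<Longrightarrow> u \<le> 0 \<Longrightarrow> c u \<in> near f"
    using assms unfolding chart_def by simp_all
  fix y assume y: "y \<in> \<Gamma>" "dist (\<sigma> 0) y < R"
  then obtain u where "\<bar>u\<bar> < R" "y = c u" using assms unfolding chart_def by blast
  then show "\<exists>u. \<bar>u\<bar> = dist (\<sigma> 0) y \<and> y = c u"
    using iso[of 0 u] c0[of 0] by (intro exI[of _ u]) auto
qed

text \<open>A point of degree 2 in \<open>near f\<close> that is the end of a segment has its other side in \<open>near f\<close>:
  otherwise a small ball around it would split off from the connected set \<open>near f\<close>.\<close>

lemma chart_exists:
  assumes \<sigma>: "\<sigma> \<in> segs f" and V: "\<sigma> 0 \<notin> V" and q: "\<sigma> 0 \<noteq> q"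
  shows "\<exists>R c. chart \<sigma> R c"
proof -
  have \<Gamma>: "\<Gamma> = V \<union> (\<Union>e<n. \<phi> e ` {0..w e})"
    and vert: "\<And>e. e < n \<Longrightarrow> \<phi> e 0 \<in> V \<and> \<phi> e (w e) \<in> V"
    using model unfolding graph_model_def by (elim conjE; simp)+
  have "\<sigma> 0 \<in> \<Gamma>" using seg(1)[OF \<sigma>] near_far(1) by blast
  then obtain e t where e: "e < n" and "t \<in> {0..w e}" and \<sigma>0: "\<sigma> 0 = \<phi> e t"
    using V unfolding \<Gamma> by blast
  moreover have "t \<noteq> 0" "t \<noteq> w e" using vert[OF e] V \<sigma>0 by auto
  ultimately have t: "t \<in> {0<..<w e}" by auto
  obtain R0 where R0: "0 < R0"
    "\<And>u v. \<bar>u\<bar> < R0 \<Longrightarrow> \<bar>v\<bar> < R0 \<Longrightarrow> dist (\<phi> e (t + u)) (\<phi> e (t + v)) = \<bar>u - v\<bar>"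
    "\<And>u. \<bar>u\<bar> < R0 \<Longrightarrow> \<phi> e (t + u) \<in> \<Gamma>"
    "\<And>y. y \<in> \<Gamma> \<Longrightarrow> dist (\<phi> e t) y < R0 \<Longrightarrow> \<exists>u. \<bar>u\<bar> < R0 \<and> y = \<phi> e (t + u)"
    using edge_point_chart[OF model e t] by blast
  have R0': "\<exists>u. \<bar>u\<bar> = dist (\<sigma> 0) y \<and> y = \<phi> e (t + u)" if y: "y \<in> \<Gamma>" "dist (\<sigma> 0) y < R0" for y
  proof -
    obtain u where "\<bar>u\<bar> < R0" "y = \<phi> e (t + u)" using R0(4)[OF y(1)] y(2) \<sigma>0 by auto
    then show ?thesis using R0(2)[of 0 u] R0(1) \<sigma>0 by auto
  qed
  define R where "R = min R0 (min (len f) (dist (\<sigma> 0) q))"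
  have R: "0 < R" "R \<le> R0" "R \<le> len f" "R \<le> dist (\<sigma> 0) q"
    using R0(1) near_far(8) q by (auto simp: R_def)
  \<comment> \<open>On an edge there are only two points at distance \<open>u\<close> from the
    centre, one on each side.\<close>
  have side: "\<sigma> u = \<phi> e (t + u) \<or> \<sigma> u = \<phi> e (t - u)" if u: "0 < u" "u < R" for u
  proof -
    have d: "dist (\<sigma> 0) (\<sigma> u) = u" using seg_isometric[OF \<sigma>, of 0 u] u R by simp
    moreover have "\<sigma> u \<in> \<Gamma>" using seg(3)[OF \<sigma>] u R by force
    ultimately obtain h where h: "\<bar>h\<bar> = u" "\<sigma> u = \<phi> e (t + h)"
      using R0'[of "\<sigma> u"] u R by auto
    then show ?thesis by (cases "h \<ge> 0") auto
  qed
  \<comment> \<open>The sign \<open>d\<close> records the direction in which the segment leaves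
    along the edge, read off at one sample point.\<close>
  obtain d :: real where d: "d = 1 \<or> d = - 1" "\<sigma> (R / 2) = \<phi> e (t + d * (R / 2))"
    using side[of "R / 2"] R(1) that[of 1] that[of "- 1"] by auto
  define c where "c u = \<phi> e (t + d * u)" for u
  have abs_d: "\<bar>d * u\<bar> = \<bar>u\<bar>" for u using d(1) by auto
  have iso: "dist (c u) (c v) = \<bar>u - v\<bar>" if "\<bar>u\<bar> < R" "\<bar>v\<bar> < R" for u v
    using R0(2)[of "d * u" "d * v"] abs_d[of u] abs_d[of v] abs_d[of "u - v"] that R(2)
    unfolding c_def by (simp add: right_diff_distrib)
  have c_\<Gamma>: "c u \<in> \<Gamma>" if "\<bar>u\<bar> < R" for u
    using R0(3)[of "d * u"] abs_d[of u] that R(2) unfolding c_def by simp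
  have onto: "\<exists>u. \<bar>u\<bar> = dist (\<sigma> 0) y \<and> y = c u" if y: "y \<in> \<Gamma>" "dist (\<sigma> 0) y < R" for y
  proof -
    obtain h where h: "\<bar>h\<bar> = dist (\<sigma> 0) y" "y = \<phi> e (t + h)"
      using R0'[OF y(1)] y(2) R(2) by auto
    have "d * (d * h) = h" using d(1) by auto
    then show ?thesis using h unfolding c_def by (intro exI[of _ "d * h"]) (simp only: abs_d)
  qed
  have pos: "c u = \<sigma> u" if u: "0 \<le> u" "u < R" for u
  proof (cases "u = 0")
    case False
    have "\<sigma> u = c u \<or> \<sigma> u = c (- u)"
      using side[of u] u False d(1) unfolding c_def by auto
    \<comment> \<open>The segment cannot switch sides: its point would then be
      \<open>u + R / 2\<close> away from the sample point instead of \<bar>u - R / 2\<bar>.\<close>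
    moreover have "\<sigma> u \<noteq> c (- u)"
    proof
      assume *: "\<sigma> u = c (- u)"
      have "dist (c (- u)) (c (R / 2)) = u + R / 2" using iso[of "- u" "R / 2"] u R(1) by simp
      moreover have "dist (\<sigma> u) (\<sigma> (R / 2)) = \<bar>u - R / 2\<bar>"
        using seg_isometric[OF \<sigma>] u R by simp
      ultimately show False using * d(2) u(1) False R(1) unfolding c_def by (auto simp: abs_if split: if_splits)
    qed
    ultimately show ?thesis by simp
  qed (simp add: c_def \<sigma>0)
  \<comment> \<open>The sphere of radius \<open>u\<close> consists of \<open>c u\<close>, which lies
    inside the segment, and \<open>c (- u)\<close>. If neither were in \<open>near f\<close>, the
    sphere would separate \<open>\<sigma> 0\<close> from \<open>q\<close> within
    \<open>near f\<close>.\<close>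
  have neg: "c (- u) \<in> near f" if u: "0 < u" "u < R" for u
  proof (rule ccontr)
    assume *: "c (- u) \<notin> near f"
    have sphere: "dist (\<sigma> 0) p \<noteq> u" if "p \<in> near f" for p
    proof
      assume p: "dist (\<sigma> 0) p = u"
      have "p \<in> \<Gamma>" using that near_far(1) by blast
      then obtain v where "\<bar>v\<bar> = u" "p = c v" using onto p u by metis
      moreover have "c u \<notin> near f" using pos[of u] u seg_in_middle[OF \<sigma>, of u] R(3) by simp
      ultimately show False using * that by (cases "0 \<le> v") auto
    qed
    have "ball (\<sigma> 0) u \<inter> near f = {} \<or> - cball (\<sigma> 0) u \<inter> near f = {}"
    proof (rule connectedD[OF near_far(6)])
      show "near f \<subseteq> ball (\<sigma> 0) u \<union> - cball (\<sigma> 0) u"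
        using sphere by force
    qed (auto simp: open_Compl)
    moreover have "\<sigma> 0 \<in> ball (\<sigma> 0) u \<inter> near f" using seg(1)[OF \<sigma>] u by simp
    moreover have "q \<in> - cball (\<sigma> 0) u \<inter> near f" using near_far(7) u R(4) by simp
    ultimately show False by blast
  qed
  have "chart \<sigma> R c"
    unfolding chart_def
  proof (intro conjI allI ballI impI)
    show "c u \<in> near f" if "- R < u \<and> u \<le> 0" for u
      using neg[of "- u"] pos[of 0] seg(1)[OF \<sigma>] that R(1) by (cases "u = 0") auto
    show "\<exists>u. \<bar>u\<bar> < R \<and> y = c u" if "y \<in> \<Gamma>" "dist (\<sigma> 0) y < R" for y
      using onto[OF that] that(2) by metis
  qed (use R iso c_\<Gamma> pos in auto)
  then show ?thesis by blast
qed

text \<open>At distance \<open>R / 2\<close> from the common end there are only two points and one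
  of them is in \<open>near f\<close>, so both segments pass through the other. Distinct near ends
  are what gives the positive distances used for the prolongation.\<close>

lemma near_end_unique:
  assumes \<sigma>: "\<sigma> \<in> segs f" "chart \<sigma> R c" and \<tau>: "\<tau> \<in> segs f" "\<tau> 0 = \<sigma> 0"
  shows "\<tau> = \<sigma>"
proof -
  note c = chartD[OF \<sigma>(2)]
  let ?u = "R / 2"
  have u: "?u \<in> {0<..<len f}" "?u \<in> {0..len f}" using c(1,2) by auto
  have "dist (\<sigma> 0) (\<tau> ?u) = ?u"
    using seg_isometric[OF \<tau>(1), of 0 ?u] \<tau>(2) u by simp
  then obtain v where v: "\<bar>v\<bar> = ?u" "\<tau> ?u = c v"
    using c(6)[of "\<tau> ?u"] seg_in_middle(1)[OF \<tau>(1) u(1)] c(1) by auto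
  have "v = ?u"
  proof (rule ccontr)
    assume "v \<noteq> ?u"
    then have "v = - ?u" using v(1) by linarith
    then have "c v \<in> near f" using c(8)[of v] c(1) by simp
    then show False using seg_in_middle(2)[OF \<tau>(1) u(1)] v(2) by simp
  qed
  moreover have "c ?u = \<sigma> ?u" using c(1) by (intro c(7)) auto
  ultimately have "\<tau> ?u = \<sigma> ?u" using v(2) by metis
  then show ?thesis using seg_eq(1)[OF \<tau>(1) \<sigma>(1) u(1) u(1)] by blast
qed

text \<open>All segments are extended backwards by one small amount. Keeping \<open>far f\<close>
  makes the new firing a competitor in the definition of maximality, and the bound on the numbers of
  far ends lets it inherit legality there.\<close>

lemma prolongation_exists:
  assumes ends: "\<And>\<sigma>. \<sigma> \<in> segs f \<Longrightarrow> \<sigma> 0 \<notin> V \<and> \<sigma> 0 \<noteq> q"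
  obtains g where "is_firing \<Gamma> q g" "far g = far f" "len f < len g"
    "\<And>p. card {\<sigma> \<in> segs g. \<sigma> (len g) = p} \<le> card {\<sigma> \<in> segs f. \<sigma> (len f) = p}"
proof -
  have "\<forall>\<sigma>. \<exists>R c. \<sigma> \<in> segs f \<longrightarrow> chart \<sigma> R c" using chart_exists ends by blast
  then obtain R c where chart: "\<And>\<sigma>. \<sigma> \<in> segs f \<Longrightarrow> chart \<sigma> (R \<sigma>) (c \<sigma>)"
    by metis
  note ch = chartD[OF chart]
  \<comment> \<open>A length below half of everything in \<open>S\<close> stays inside every chart
    and makes the balls around different near ends disjoint.\<close>
  define S where "S = R ` segs f \<union> (\<lambda>(\<sigma>, \<tau>). dist (\<sigma> 0) (\<tau> 0)) ` {(\<sigma>, \<tau>) \<in> segs f \<times> segs f. \<sigma> \<noteq> \<tau>}"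
  have "finite {(\<sigma>, \<tau>) \<in> segs f \<times> segs f. \<sigma> \<noteq> \<tau>}"
    by (rule finite_subset[of _ "segs f \<times> segs f"]) (use near_far(9) in auto)
  then have "finite S" unfolding S_def using near_far(9) by blast
  moreover have "0 < x" if x: "x \<in> S" for x
  proof -
    from x consider \<sigma> where "\<sigma> \<in> segs f" "x = R \<sigma>"
      | \<sigma> \<tau> where "\<sigma> \<in> segs f" "\<tau> \<in> segs f" "\<sigma> \<noteq> \<tau>" "x = dist (\<sigma> 0) (\<tau> 0)"
      unfolding S_def by auto
    then show ?thesis
    proof cases
      case 2
      then have "\<sigma> 0 \<noteq> \<tau> 0" using near_end_unique[OF 2(2) chart[OF 2(2)] 2(1)] by auto
      then show ?thesis using 2(4) by simp
    qed (use ch(1) in simp)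
  qed
  ultimately obtain \<eta> where \<eta>: "0 < \<eta>" and \<eta>_S: "\<And>x. x \<in> S \<Longrightarrow> 2 * \<eta> < x"
    using finite_positive_bound by blast
  have \<eta>_R: "2 * \<eta> < R \<sigma>" if "\<sigma> \<in> segs f" for \<sigma>
    by (rule \<eta>_S) (use that in \<open>simp add: S_def\<close>)
  have \<eta>_dist: "2 * \<eta> < dist (\<sigma> 0) (\<tau> 0)" if "\<sigma> \<in> segs f" "\<tau> \<in> segs f" "\<sigma> \<noteq> \<tau>" for \<sigma> \<tau>
    by (rule \<eta>_S) (use that in \<open>force simp: S_def\<close>)

  \<comment> \<open>Every segment grows by \<open>\<eta>\<close> into \<open>near f\<close>, which therefore loses the balls in \<open>U\<close>.\<close>
  define E where "E \<sigma> t = (if t < \<eta> then c \<sigma> (t - \<eta>) else \<sigma> (t - \<eta>))" for \<sigma> :: "real \<Rightarrow> 'a" and t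
  define U where "U = (\<Union>\<sigma>\<in>segs f. ball (\<sigma> 0) \<eta>)"
  define g where "g = \<lparr>near = near f - U, far = far f, len = len f + \<eta>, segs = E ` segs f\<rparr>"
  \<comment> \<open>The branches of \<open>E\<close> overlap, because \<open>c\<close> agrees with
    the segment at nonnegative coordinates. So a single chart describes \<open>E\<close> on both
    sides of the old near end.\<close>
  have E_chart: "E \<sigma> t = c \<sigma> (t - \<eta>)" if "\<sigma> \<in> segs f" "t < 2 * \<eta>" for \<sigma> t
    using ch(7)[OF that(1), of "t - \<eta>"] \<eta>_R[OF that(1)] that(2) \<eta> unfolding E_def by auto
  have c0: "c \<sigma> 0 = \<sigma> 0" if "\<sigma> \<in> segs f" for \<sigma>
    using ch(7)[OF that, of 0] ch(1)[OF that] by simp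
  have E_seg: "E \<sigma> t = \<sigma> (t - \<eta>)" if "\<eta> < t" for \<sigma> t
    using that unfolding E_def by simp
  have E_near: "E \<sigma> t \<in> near f" "dist (\<sigma> 0) (E \<sigma> t) = \<eta> - t" if "\<sigma> \<in> segs f" "0 \<le> t" "t \<le> \<eta>" for \<sigma> t
  proof -
    have "E \<sigma> t = c \<sigma> (t - \<eta>)" using E_chart[of \<sigma> t] that \<eta> by simp
    then show "E \<sigma> t \<in> near f" "dist (\<sigma> 0) (E \<sigma> t) = \<eta> - t"
      using ch(8)[OF that(1), of "t - \<eta>"] ch(4)[OF that(1), of 0 "t - \<eta>"] c0[OF that(1)]
        \<eta>_R[OF that(1)] that \<eta> by simp_all
  qed
  have E_middle: "E \<sigma> t \<in> \<Gamma>" "E \<sigma> t \<notin> near f" "E \<sigma> t \<notin> far f"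
    if "\<sigma> \<in> segs f" "\<eta> < t" "t < len f + \<eta>" for \<sigma> t
    using seg_in_middle[OF that(1), of "t - \<eta>"] E_seg[of t \<sigma>] that by auto
  have len_E: "E \<sigma> (len f + \<eta>) = \<sigma> (len f)" for \<sigma>
    using near_far(8) unfolding E_def by simp
  have E_near_iff: "E \<sigma> t \<in> near f \<longleftrightarrow> t \<le> \<eta>" if "\<sigma> \<in> segs f" "t \<in> {0<..<len f + \<eta>}" for \<sigma> t
    using E_near(1)[OF that(1), of t] E_middle(2)[OF that(1), of t] that(2) by (cases "t \<le> \<eta>") auto
  \<comment> \<open>Injectivity of each grown segment and disjointness of different ones are
    obtained together. A common point in \<open>near f\<close> would be within \<eta> of two near
    ends that are more than \<open>2 * \<eta>\<close> apart.\<close>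
  have E_eq: "\<sigma> = \<tau> \<and> s = t"
    if \<sigma>: "\<sigma> \<in> segs f" and \<tau>: "\<tau> \<in> segs f" and s: "s \<in> {0<..<len f + \<eta>}"
      and t: "t \<in> {0<..<len f + \<eta>}" and eq: "E \<sigma> s = E \<tau> t"
    for \<sigma> \<tau> s t
  proof -
    have iff: "s \<le> \<eta> \<longleftrightarrow> t \<le> \<eta>" using E_near_iff[OF \<sigma> s] E_near_iff[OF \<tau> t] eq by simp
    show ?thesis
    proof (cases "s \<le> \<eta>")
      case True
      have d: "dist (\<sigma> 0) (E \<sigma> s) = \<eta> - s" "dist (\<tau> 0) (E \<sigma> s) = \<eta> - t"
        using E_near(2)[OF \<sigma>, of s] E_near(2)[OF \<tau>, of t] s t True iff eq by simp_all
      have "\<sigma> = \<tau>"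
      proof (rule ccontr)
        assume "\<sigma> \<noteq> \<tau>"
        then have "2 * \<eta> < dist (\<sigma> 0) (\<tau> 0)" using \<eta>_dist[OF \<sigma> \<tau>] by simp
        also have "\<dots> \<le> (\<eta> - s) + (\<eta> - t)"
          using dist_triangle2[of "\<sigma> 0" "\<tau> 0" "E \<sigma> s"] unfolding d .
        finally show False using s t by simp
      qed
      then show ?thesis using d by simp
    next
      case False
      then have "\<sigma> (s - \<eta>) = \<tau> (t - \<eta>)" using E_seg[of s \<sigma>] E_seg[of t \<tau>] iff eq by simp
      from seg_eq[OF \<sigma> \<tau> _ _ this] show ?thesis using False iff s t by auto
    qed
  qed
  have param: "segment_param \<Gamma> (len f + \<eta>) (E \<sigma>)" if \<sigma>: "\<sigma> \<in> segs f" for \<sigma>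
    unfolding segment_param_def
  proof (intro conjI ballI)
    show "E \<sigma> ` {0..len f + \<eta>} \<subseteq> \<Gamma>"
    proof
      fix x assume "x \<in> E \<sigma> ` {0..len f + \<eta>}"
      then obtain t where t: "x = E \<sigma> t" "0 \<le> t" "t \<le> len f + \<eta>" by auto
      then consider "t \<le> \<eta>" | "\<eta> < t" "t < len f + \<eta>" | "t = len f + \<eta>" by linarith
      then show "x \<in> \<Gamma>"
      proof cases
        case 1
        then show ?thesis using E_near(1)[OF \<sigma> t(2)] t(1) near_far(1) by blast
      next
        case 2
        then show ?thesis using E_middle(1)[OF \<sigma>] t(1) by simp
      next
        case 3
        then show ?thesis using len_E seg(2)[OF \<sigma>] near_far(2) t(1) by auto
      qed
    qed
    have "1-lipschitz_on {0..\<eta>} (\<lambda>t. c \<sigma> (t - \<eta>))"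
    proof (rule lipschitz_onI)
      fix x y assume "x \<in> {0..\<eta>}" "y \<in> {0..\<eta>}"
      then show "dist (c \<sigma> (x - \<eta>)) (c \<sigma> (y - \<eta>)) \<le> 1 * dist x y"
        using ch(4)[OF \<sigma>, of "x - \<eta>" "y - \<eta>"] \<eta>_R[OF \<sigma>] \<eta> by (simp add: dist_real_def)
    qed simp
    moreover have "1-lipschitz_on {\<eta>..len f + \<eta>} (\<lambda>t. \<sigma> (t - \<eta>))"
    proof (rule lipschitz_onI)
      fix x y assume "x \<in> {\<eta>..len f + \<eta>}" "y \<in> {\<eta>..len f + \<eta>}"
      then show "dist (\<sigma> (x - \<eta>)) (\<sigma> (y - \<eta>)) \<le> 1 * dist x y"
        using seg_isometric[OF \<sigma>, of "x - \<eta>" "y - \<eta>"] by (simp add: dist_real_def)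
    qed simp
    ultimately have "continuous_on ({0..\<eta>} \<union> {\<eta>..len f + \<eta>}) (E \<sigma>)"
      unfolding E_def[abs_def]
    proof (intro continuous_on_cases)
      show "\<forall>x. x \<in> {0..\<eta>} \<and> \<not> x < \<eta> \<or> x \<in> {\<eta>..len f + \<eta>} \<and> x < \<eta> \<longrightarrow> c \<sigma> (x - \<eta>) = \<sigma> (x - \<eta>)"
        using c0[OF \<sigma>] by auto
    qed (auto intro: lipschitz_on_continuous_on)
    moreover have "{0..\<eta>} \<union> {\<eta>..len f + \<eta>} = {0..len f + \<eta>}"
      using \<eta> near_far(8) by auto
    ultimately show "continuous_on {0..len f + \<eta>} (E \<sigma>)" by simp
    show "inj_on (E \<sigma>) {0<..<len f + \<eta>}"
      using E_eq[OF \<sigma> \<sigma>] by (intro inj_onI) blast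
    fix t assume t: "t \<in> {0<..<len f + \<eta>}"
    show "\<exists>\<delta>>0. \<forall>s\<in>{0<..<len f + \<eta>}. \<forall>u\<in>{0<..<len f + \<eta>}.
        \<bar>s - t\<bar> < \<delta> \<longrightarrow> \<bar>u - t\<bar> < \<delta> \<longrightarrow> dist (E \<sigma> s) (E \<sigma> u) = \<bar>s - u\<bar>"
    \<comment> \<open>Up to \<eta>, a window of radius \<eta> stays below \<open>2 * \<eta>\<close>
      and hence in the chart; beyond \<eta>, a window of radius \<open>t - \<eta>\<close> stays on
      the old segment.\<close>
    proof (cases "t \<le> \<eta>")
      case True
      show ?thesis
      proof (intro exI[of _ \<eta>] conjI ballI impI \<eta>)
        fix s u assume su: "s \<in> {0<..<len f + \<eta>}" "u \<in> {0<..<len f + \<eta>}" "\<bar>s - t\<bar> < \<eta>" "\<bar>u - t\<bar> < \<eta>"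
        then have "s < 2 * \<eta>" "u < 2 * \<eta>" using True by auto
        then show "dist (E \<sigma> s) (E \<sigma> u) = \<bar>s - u\<bar>"
          using ch(4)[OF \<sigma>, of "s - \<eta>" "u - \<eta>"] E_chart[OF \<sigma>, of s] E_chart[OF \<sigma>, of u] su \<eta>_R[OF \<sigma>] \<eta>
          by auto
      qed
    next
      case False
      show ?thesis
      proof (intro exI[of _ "t - \<eta>"] conjI ballI impI)
        fix s u assume su: "s \<in> {0<..<len f + \<eta>}" "u \<in> {0<..<len f + \<eta>}"
          "\<bar>s - t\<bar> < t - \<eta>" "\<bar>u - t\<bar> < t - \<eta>"
        then have "\<eta> < s" "\<eta> < u" by linarith+
        then show "dist (E \<sigma> s) (E \<sigma> u) = \<bar>s - u\<bar>"
          using seg_isometric[OF \<sigma>, of "s - \<eta>" "u - \<eta>"] E_seg[of s \<sigma>] E_seg[of u \<sigma>] su by simp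
      qed (use False in simp)
    qed
  qed
  have E0: "E \<sigma> 0 \<in> near f - U" if \<sigma>: "\<sigma> \<in> segs f" for \<sigma>
  proof -
    have *: "E \<sigma> 0 \<in> near f" "dist (\<sigma> 0) (E \<sigma> 0) = \<eta>"
      using E_near[OF \<sigma>, of 0] \<eta> by simp_all
    have "\<eta> \<le> dist (\<tau> 0) (E \<sigma> 0)" if \<tau>: "\<tau> \<in> segs f" for \<tau>
    proof (cases "\<tau> = \<sigma>")
      case False
      from \<eta>_dist[OF \<tau> \<sigma> this] show ?thesis
        using dist_triangle2[of "\<tau> 0" "\<sigma> 0" "E \<sigma> 0"] *(2) by linarith
    qed (use *(2) in simp)
    then show ?thesis using *(1) unfolding U_def by force
  qed
  have in_U: "E \<sigma> t \<in> U" if "\<sigma> \<in> segs f" "0 < t" "t \<le> \<eta>" for \<sigma> t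
    using E_near(2)[OF that(1), of t] that unfolding U_def by force
  \<comment> \<open>What \<open>near f\<close> loses are the points of nonpositive coordinate in the
    balls, and these are exactly the added parts of the segments.\<close>
  have middle': "\<Gamma> - (near f - U \<union> far f) = (\<Union>\<tau>\<in>segs f. E \<tau> ` {0<..<len f + \<eta>})" (is "?L = ?R")
  proof (intro equalityI subsetI)
    fix x assume x: "x \<in> ?L"
    show "x \<in> ?R"
    proof (cases "x \<in> near f")
      case False
      then obtain \<sigma> t where "\<sigma> \<in> segs f" "t \<in> {0<..<len f}" "x = \<sigma> t"
        using x middle by blast
      then show ?thesis using \<eta> E_seg[of "t + \<eta>" \<sigma>] by (intro UN_I[of \<sigma>] image_eqI[of _ _ "t + \<eta>"]) auto
    next
      case True
      then obtain \<sigma> where \<sigma>: "\<sigma> \<in> segs f" "dist (\<sigma> 0) x < \<eta>"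
        using x unfolding U_def by auto
      then obtain u where u: "\<bar>u\<bar> < \<eta>" "x = c \<sigma> u"
        using ch(6)[OF \<sigma>(1), of x] \<eta>_R[OF \<sigma>(1)] \<eta> x by force
      have "u \<le> 0"
      proof (rule ccontr)
        assume "\<not> u \<le> 0"
        then show False
          using ch(7)[OF \<sigma>(1), of u] \<eta>_R[OF \<sigma>(1)] seg_in_middle(2)[OF \<sigma>(1), of u] u True ch(2)[OF \<sigma>(1)] \<eta>
          by auto
      qed
      then show ?thesis using u \<sigma>(1) E_chart[OF \<sigma>(1), of "u + \<eta>"] near_far(8) \<eta>
        by (intro UN_I[of \<sigma>] image_eqI[of _ _ "u + \<eta>"]) auto
    qed
  next
    fix x assume "x \<in> ?R"
    then obtain \<sigma> t where *: "\<sigma> \<in> segs f" "0 < t" "t < len f + \<eta>" "x = E \<sigma> t" by auto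
    show "x \<in> ?L"
    proof (cases "t \<le> \<eta>")
      case True
      then show ?thesis using E_near(1)[OF *(1), of t] in_U[OF *(1), of t] * near_far(1,3) by auto
    qed (use E_middle[OF *(1), of t] * in auto)
  qed
  have "connected (near f - U)"
    unfolding U_def
  proof (rule connected_minus_balls[OF near_far(9,6,4)])
    fix \<sigma> assume \<sigma>: "\<sigma> \<in> segs f"
    \<comment> \<open>The second point of the sphere, with coordinate \<eta>, lies inside the
      segment and therefore not in \<open>near f\<close>.\<close>
    show "near f \<inter> sphere (\<sigma> 0) \<eta> \<subseteq> {c \<sigma> (- \<eta>)}"
    proof
      fix x assume "x \<in> near f \<inter> sphere (\<sigma> 0) \<eta>"
      then have x: "x \<in> near f" "dist (\<sigma> 0) x = \<eta>" by auto
      then obtain u where u: "\<bar>u\<bar> = \<eta>" "x = c \<sigma> u"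
        using ch(6)[OF \<sigma>, of x] \<eta>_R[OF \<sigma>] \<eta> near_far(1) by force
      have "u \<noteq> \<eta>"
        using ch(7)[OF \<sigma>, of \<eta>] \<eta>_R[OF \<sigma>] seg_in_middle(2)[OF \<sigma>, of \<eta>] u x(1) ch(2)[OF \<sigma>] \<eta> by auto
      then have "u = - \<eta>" using u(1) by linarith
      then show "x \<in> {c \<sigma> (- \<eta>)}" using u(2) by simp
    qed
  qed
  moreover have "closed (near f - U)"
    unfolding U_def using near_far(4) by (intro closed_Diff open_UN) auto
  moreover have "q \<in> near f - U"
    using near_far(7) ch(3) \<eta>_R \<eta> unfolding U_def by fastforce
  moreover have "disjoint_family_on (\<lambda>\<sigma>. \<sigma> ` {0<..<len f + \<eta>}) (E ` segs f)"
    unfolding disjoint_family_on_def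
  proof (intro ballI impI)
    fix \<sigma>' \<tau>' assume "\<sigma>' \<in> E ` segs f" "\<tau>' \<in> E ` segs f" "\<sigma>' \<noteq> \<tau>'"
    then obtain \<sigma> \<tau> where "\<sigma> \<in> segs f" "\<tau> \<in> segs f" "\<sigma>' = E \<sigma>" "\<tau>' = E \<tau>" "\<sigma> \<noteq> \<tau>" by auto
    then show "\<sigma>' ` {0<..<len f + \<eta>} \<inter> \<tau>' ` {0<..<len f + \<eta>} = {}"
      using E_eq by fastforce
  qed
  moreover have "far f \<noteq> {}" "connected (far f)"
    using firing unfolding is_firing_def by simp_all
  moreover have "near f - U \<subseteq> \<Gamma>" "(near f - U) \<inter> far f = {}" using near_far(1,3) by auto
  moreover have "E \<sigma> (len f + \<eta>) \<in> far f" if "\<sigma> \<in> segs f" for \<sigma>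
    using seg(2)[OF that] len_E by simp
  ultimately have "is_firing \<Gamma> q g"
    unfolding is_firing_def g_def using near_far(2,5,8,9) \<eta> param E0 middle' by simp
  moreover have "card {\<sigma> \<in> segs g. \<sigma> (len g) = p} \<le> card {\<sigma> \<in> segs f. \<sigma> (len f) = p}" for p
  proof -
    have "{\<sigma> \<in> segs g. \<sigma> (len g) = p} \<subseteq> E ` {\<sigma> \<in> segs f. \<sigma> (len f) = p}"
      unfolding g_def using len_E by auto
    then show ?thesis using near_far(9) by (intro surj_card_le) auto
  qed
  ultimately show thesis using that[of g] \<eta> by (simp add: g_def)
qed

end

section \<open>Counting chips\<close>

text \<open>The value at \<open>g\<close> of the linear functional extending \<open>chip p \<mapsto> g p\<close>.\<close>

definition weight :: "('a \<Rightarrow> 'b::comm_ring_1) \<Rightarrow> 'a divisor \<Rightarrow> 'b" where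
  "weight g E = (\<Sum>p\<in>Poly_Mapping.keys E. of_int (coeff_at E p) * g p)"

lemma weight_superset:
  "finite A \<Longrightarrow> Poly_Mapping.keys E \<subseteq> A \<Longrightarrow> weight g E = (\<Sum>p\<in>A. of_int (coeff_at E p) * g p)"
  unfolding weight_def by (rule sum.mono_neutral_left) (auto simp: in_keys_iff)

lemma weight_add: "weight g (E + F) = weight g E + weight g F"
proof -
  let ?A = "Poly_Mapping.keys E \<union> Poly_Mapping.keys F"
  have "Poly_Mapping.keys (E + F) \<subseteq> ?A" by (rule Poly_Mapping.keys_add)
  then show ?thesis
    by (simp add: weight_superset[of ?A] lookup_add algebra_simps sum.distrib)
qed

lemma weight_diff: "weight g (E - F) = weight g E - weight g F"
  using weight_add[of g "E - F" F] by simp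

lemma weight_zero: "weight g 0 = 0"
  by (simp add: weight_def)

lemma weight_single: "weight g (Poly_Mapping.single p a) = of_int a * g p"
  by (simp add: weight_superset[of "{p}"])

lemma weight_sum: "weight g (\<Sum>i\<in>I. E i) = (\<Sum>i\<in>I. weight g (E i))"
  by (induction I rule: infinite_finite_induct) (simp_all add: weight_zero weight_add)

lemma coeff_at_chips: "finite I \<Longrightarrow> coeff_at (\<Sum>i\<in>I. chip (x i)) p = int (card {i \<in> I. x i = p})"
  by (simp add: lookup_sum lookup_single when_def sum.If_cases) (rule arg_cong[of _ _ card]; auto)

lemma coeff_at_firing_div:
  assumes "finite (segs f)"
  shows "coeff_at (firing_div f) p =
    int (card {\<sigma> \<in> segs f. \<sigma> (len f) = p}) - int (card {\<sigma> \<in> segs f. \<sigma> 0 = p})"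
  unfolding firing_div_def sum_subtractf lookup_minus by (simp only: coeff_at_chips assms)

lemma weight_firing_div:
  "weight g (firing_div f) = (\<Sum>\<sigma>\<in>segs f. g (\<sigma> (len f)) - g (\<sigma> 0))"
  unfolding firing_div_def by (simp add: weight_sum weight_diff weight_single)

section \<open>How a firing changes coefficients, energy and contact with the vertices\<close>

context model_firing
begin

lemma coeff_at_firing_div_near:
  assumes "p \<in> near f"
  shows "coeff_at (firing_div f) p = - int (card {\<sigma> \<in> segs f. \<sigma> 0 = p})"
proof -
  have "p \<notin> far f" using assms near_far(3) by blast
  then have empty: "{\<sigma> \<in> segs f. \<sigma> (len f) = p} = {}" using seg(2) by fast
  show ?thesis unfolding coeff_at_firing_div[OF near_far(9)] empty by simp
qed

lemma coeff_at_firing_div_not_near: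
  assumes "p \<notin> near f"
  shows "coeff_at (firing_div f) p = int (card {\<sigma> \<in> segs f. \<sigma> (len f) = p})"
proof -
  have empty: "{\<sigma> \<in> segs f. \<sigma> 0 = p} = {}" using seg(1) assms by fast
  show ?thesis unfolding coeff_at_firing_div[OF near_far(9)] empty by simp
qed

text \<open>Gains and losses cannot cancel because \<open>near f\<close> and \<open>far f\<close>
  are disjoint: near ends only receive chips and far ends only give them up.\<close>

lemma coeff_at_firing_div_pos:
  assumes "\<sigma> \<in> segs f"
  shows "coeff_at (firing_div f) (\<sigma> 0) < 0" "0 < coeff_at (firing_div f) (\<sigma> (len f))"
proof -
  have pos: "0 < card {\<tau> \<in> segs f. P \<tau>}" if "P \<sigma>" for P
  proof -
    have "\<sigma> \<in> {\<tau> \<in> segs f. P \<tau>}" using assms that by simp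
    then show ?thesis using near_far(9) by (intro card_gt_0_iff[THEN iffD2] conjI) (blast, simp)
  qed
  have "\<sigma> (len f) \<notin> near f" using seg(2)[OF assms] near_far(3) by (metis disjoint_iff)
  then have "coeff_at (firing_div f) (\<sigma> (len f)) = int (card {\<tau> \<in> segs f. \<tau> (len f) = \<sigma> (len f)})"
    by (rule coeff_at_firing_div_not_near)
  then show "0 < coeff_at (firing_div f) (\<sigma> (len f))"
    using pos[of "\<lambda>\<tau>. \<tau> (len f) = \<sigma> (len f)", OF refl] by linarith
  show "coeff_at (firing_div f) (\<sigma> 0) < 0"
    using coeff_at_firing_div_near[OF seg(1)[OF assms]] pos[of "\<lambda>\<tau>. \<tau> 0 = \<sigma> 0", OF refl] by linarith
qed

lemma keys_firing_div: "Poly_Mapping.keys (firing_div f) \<subseteq> \<Gamma>"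
proof
  fix p assume "p \<in> Poly_Mapping.keys (firing_div f)"
  then have "coeff_at (firing_div f) p \<noteq> 0" by (simp add: in_keys_iff)
  then have "{\<sigma> \<in> segs f. \<sigma> (len f) = p} \<noteq> {} \<or> {\<sigma> \<in> segs f. \<sigma> 0 = p} \<noteq> {}"
    unfolding coeff_at_firing_div[OF near_far(9)] by (metis card.empty diff_self of_nat_0)
  then obtain \<sigma> where "\<sigma> \<in> segs f" "p = \<sigma> (len f) \<or> p = \<sigma> 0" by fast
  then show "p \<in> \<Gamma>" using seg(1,2)[of \<sigma>] near_far(1,2) by auto
qed

text \<open>The left-hand side is the Dirichlet energy of the level function, computed by pairing it
  with \<open>firing_div f\<close>.\<close>

lemma energy_bound:
  assumes x: "\<And>j. j < m \<Longrightarrow> x j \<in> \<Gamma>" "E = (\<Sum>j<m. chip (x j))"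
    and y: "\<And>j. j < m \<Longrightarrow> y j \<in> \<Gamma>" "E - firing_div f = (\<Sum>j<m. chip (y j))"
  shows "real (card (segs f)) * len f \<le> (\<Sum>j<m. dist (x j) (y j))"
proof -
  have "level (\<sigma> (len f)) - level (\<sigma> 0) = len f" if "\<sigma> \<in> segs f" for \<sigma>
    using seg(1,2)[OF that] by simp
  then have "real (card (segs f)) * len f = weight level (firing_div f)"
    by (simp add: weight_firing_div)
  also have "\<dots> = weight level E - weight level (E - firing_div f)"
    by (simp add: weight_diff)
  also have "\<dots> = (\<Sum>j<m. level (x j) - level (y j))"
    unfolding y(2) unfolding x(2) weight_sum weight_single by (simp add: sum_subtractf)
  also have "\<dots> \<le> (\<Sum>j<m. dist (x j) (y j))"
  proof (rule sum_mono)
    fix j assume "j \<in> {..<m}"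
    then show "level (x j) - level (y j) \<le> dist (x j) (y j)"
      using level_lipschitz[OF x(1) y(1), of j j] by simp
  qed
  finally show ?thesis .
qed

text \<open>Otherwise the prolonged firing contradicts maximality. It is legal: on
  \<open>far f\<close> it takes away no more chips than \<open>f\<close> does, and at other points
  it takes none, where \<open>D\<close> itself is nonnegative away from \<open>q\<close>.\<close>

lemma maximal_firing_hits_vertex:
  assumes D: "\<And>p. p \<in> \<Gamma> \<Longrightarrow> p \<noteq> q \<Longrightarrow> 0 \<le> coeff_at D p"
    and max: "maximal_legal_firing \<Gamma> q D f"
  shows "\<exists>\<sigma>\<in>segs f. \<sigma> 0 \<in> insert q V"
proof (rule ccontr)
  assume "\<not> ?thesis"
  then have ends: "\<sigma> 0 \<notin> V \<and> \<sigma> 0 \<noteq> q" if "\<sigma> \<in> segs f" for \<sigma>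
    using that by simp
  obtain g where g: "is_firing \<Gamma> q g" "far g = far f" "len f < len g"
    and card: "\<And>p. card {\<sigma> \<in> segs g. \<sigma> (len g) = p} \<le> card {\<sigma> \<in> segs f. \<sigma> (len f) = p}"
  proof (rule prolongation_exists)
    show "\<sigma> 0 \<notin> V \<and> \<sigma> 0 \<noteq> q" if "\<sigma> \<in> segs f" for \<sigma> by (rule ends[OF that])
  qed (rule that)
  interpret g: model_firing \<Gamma> V n w \<phi> q g
    by unfold_locales (rule model g(1))+
  have "0 \<le> coeff_at (D - firing_div g) p" if p: "p \<in> \<Gamma>" "p \<noteq> q" for p
  proof (cases "p \<in> far f")
    case True
    then have "p \<notin> near f" "p \<notin> near g" using near_far(3) g.near_far(3) g(2) by auto
    then have "coeff_at (firing_div g) p \<le> coeff_at (firing_div f) p"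
      using card[of p] by (simp add: coeff_at_firing_div_not_near g.coeff_at_firing_div_not_near)
    moreover have "0 \<le> coeff_at (D - firing_div f) p"
      using max p unfolding maximal_legal_firing_def legal_firing_def by simp
    ultimately show ?thesis by (simp add: lookup_minus)
  next
    case False
    then have empty: "{\<sigma> \<in> segs g. \<sigma> (len g) = p} = {}" using g.seg(2) g(2) by fast
    have "coeff_at (firing_div g) p \<le> 0"
      unfolding coeff_at_firing_div[OF g.near_far(9)] empty by simp
    with D[OF p] show ?thesis by (simp add: lookup_minus)
  qed
  then have "legal_firing \<Gamma> q D g"
    unfolding legal_firing_def using g(1) by simp
  moreover have "\<forall>g. legal_firing \<Gamma> q D g \<and> far g = far f \<longrightarrow> len g \<le> len f"
    using max unfolding maximal_legal_firing_def by (rule conjunct2)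
  ultimately have "len g \<le> len f" using g(2) by simp
  then show False using g(3) by simp
qed

end

section \<open>Order types\<close>

text \<open>The hypothesis supplies some larger element; at a greatest element of the type, the
  \<open>LEAST\<close> in \<open>ord_succ\<close> would be unspecified.\<close>

lemma less_ord_succ: "\<beta> < \<gamma> \<Longrightarrow> \<beta> < ord_succ \<beta>"
  unfolding ord_succ_def by (rule LeastI)

lemma ord_succ_le: "\<beta> < \<gamma> \<Longrightarrow> ord_succ \<beta> \<le> \<gamma>"
  unfolding ord_succ_def by (rule Least_le)

lemma ord_cases:
  fixes \<beta> :: "'o::wellorder"
  obtains "\<beta> = ord_zero" | \<gamma> where "\<gamma> < \<beta>" "\<beta> = ord_succ \<gamma>" | "ord_limit \<beta>"
proof (cases "ord_limit \<beta>")
  case False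
  then consider "\<And>\<gamma>. \<not> \<gamma> < \<beta>" | \<gamma> where "\<gamma> < \<beta>" "\<And>\<delta>. \<not> (\<gamma> < \<delta> \<and> \<delta> < \<beta>)"
    unfolding ord_limit_def by blast
  then show thesis
  proof cases
    case 1
    then have "\<beta> = ord_zero"
      unfolding ord_zero_def by (intro Least_equality[symmetric]) (simp_all add: not_less)
    then show thesis by (rule that(1))
  next
    case 2
    then have "\<beta> = ord_succ \<gamma>"
      using less_ord_succ[OF 2(1)] ord_succ_le[OF 2(1)] by (metis antisym not_le)
    then show thesis using 2(1) by (rule that(2)[rotated])
  qed
qed (rule that(3))

text \<open>The map \<open>g\<close> is a cofinal sequence of type \<omega> to the power
  \<open>k\<close> below \<mu>. For \<open>k = 0\<close> this makes \<mu> a successor. In the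
  induction step \<mu> is the limit of the suprema of \<omega> shorter sequences; each supremum has
  height at least \<open>k + 1\<close>, and the late ones are strictly below the height of
  \<mu>.\<close>

lemma cofinal_omega_power_height:
  fixes c :: "'o::wellorder \<Rightarrow> int"
  assumes succ: "\<And>\<beta>. \<beta> < \<alpha> \<Longrightarrow> 1 \<le> c (ord_succ \<beta>)"
    and lim: "\<And>\<mu>. \<mu> \<le> \<alpha> \<Longrightarrow> ord_limit \<mu> \<Longrightarrow> \<exists>\<beta>\<^sub>0<\<mu>. \<forall>\<beta>. \<beta>\<^sub>0 \<le> \<beta> \<and> \<beta> < \<mu> \<longrightarrow> c \<beta> < c \<mu>"
    and "\<And>xs ys. length xs = k \<Longrightarrow> length ys = k \<Longrightarrow> (xs, ys) \<in> lexn less_than k \<Longrightarrow> g xs < g ys"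
    and "\<And>xs. length xs = k \<Longrightarrow> g xs < \<mu>"
    and "\<And>\<beta>. \<beta> < \<mu> \<Longrightarrow> \<exists>xs. length xs = k \<and> \<beta> \<le> g xs"
    and "\<mu> \<le> \<alpha>"
  shows "int k + 1 \<le> c \<mu>"
  using assms(3-)
proof (induction k arbitrary: g \<mu>)
  case 0
  have "g [] < \<mu>" using "0.prems"(2) by simp
  moreover have "\<mu> \<le> \<gamma>" if "g [] < \<gamma>" for \<gamma>
  proof (rule leI, rule notI)
    assume "\<gamma> < \<mu>"
    then obtain xs where "length xs = 0" "\<gamma> \<le> g xs" using "0.prems"(3) by blast
    then show False using that by simp
  qed
  ultimately have "ord_succ (g []) = \<mu>"
    unfolding ord_succ_def by (rule Least_equality)
  then show ?case using succ[of "g []"] \<open>g [] < \<mu>\<close> "0.prems"(4) by simp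
next
  case (Suc k)
  \<comment> \<open>This is the least strict upper bound of the \<open>n\<close>-th copy. Since
    \<open>g\<close> may jump between copies, it can lie below the first value of the next copy;
    that value shows that the bound exists and is below \<mu>.\<close>
  define \<nu> where "\<nu> n = (LEAST \<gamma>. \<forall>xs. length xs = k \<longrightarrow> g (n # xs) < \<gamma>)" for n
  have next_copy: "\<forall>xs. length xs = k \<longrightarrow> g (n # xs) < g (Suc n # replicate k 0)" for n
  proof (intro allI impI)
    fix xs :: "nat list" assume "length xs = k"
    then show "g (n # xs) < g (Suc n # replicate k 0)"
      by (intro Suc.prems(1)) (simp_all only: lexn_less_than_Cons length_replicate length_Cons lessI simp_thms)
  qed
  have \<nu>_less: "\<nu> n < \<mu>" for n
  proof -
    have "\<nu> n \<le> g (Suc n # replicate k 0)"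
      unfolding \<nu>_def using next_copy by (rule Least_le)
    also have "\<dots> < \<mu>" by (rule Suc.prems(2)) simp
    finally show ?thesis .
  qed
  have \<nu>: "g (n # xs) < \<nu> n" if "length xs = k" for n xs
  proof -
    have "\<forall>xs. length xs = k \<longrightarrow> g (n # xs) < \<nu> n"
      unfolding \<nu>_def using next_copy by (rule LeastI[of "\<lambda>\<gamma>. \<forall>xs. length xs = k \<longrightarrow> g (n # xs) < \<gamma>"])
    then show ?thesis using that by blast
  qed
  have c_\<nu>: "int k + 1 \<le> c (\<nu> n)" for n
  proof (rule Suc.IH[of "\<lambda>xs. g (n # xs)"])
    show "g (n # xs) < g (n # ys)" if "length xs = k" "length ys = k" "(xs, ys) \<in> lexn less_than k" for xs ys
      using that by (intro Suc.prems(1)) (simp_all only: lexn_less_than_Cons length_Cons simp_thms)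
    show "\<exists>xs. length xs = k \<and> \<beta> \<le> g (n # xs)" if "\<beta> < \<nu> n" for \<beta>
      using not_less_Least[OF that[unfolded \<nu>_def]] by (auto simp: not_less)
    show "\<nu> n \<le> \<alpha>" using \<nu>_less[of n] Suc.prems(4) by simp
  qed (rule \<nu>)
  have cofinal: "\<exists>n. \<beta> < \<nu> n" if \<beta>: "\<beta> < \<mu>" for \<beta>
  proof -
    obtain xs where xs: "length xs = Suc k" "\<beta> \<le> g xs" using Suc.prems(3)[OF \<beta>] by blast
    then obtain n ys where "xs = n # ys" "length ys = k" by (cases xs) auto
    then show ?thesis using \<nu>[of ys n] xs(2) by (intro exI[of _ n]) auto
  qed
  have "ord_limit \<mu>"
    unfolding ord_limit_def using \<nu>_less cofinal by blast
  then obtain \<beta>\<^sub>0 where \<beta>\<^sub>0: "\<beta>\<^sub>0 < \<mu>" "\<And>\<beta>. \<beta>\<^sub>0 \<le> \<beta> \<Longrightarrow> \<beta> < \<mu> \<Longrightarrow> c \<beta> < c \<mu>"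
    using lim[OF Suc.prems(4)] by blast
  obtain n where "\<beta>\<^sub>0 < \<nu> n" using cofinal[OF \<beta>\<^sub>0(1)] by blast
  then have "c (\<nu> n) < c \<mu>" using \<beta>\<^sub>0(2) \<nu>_less by simp
  with c_\<nu>[of n] show ?case by simp
qed

text \<open>Otherwise the omega power is isomorphic to the elements below some \<mu> < \<alpha>. The
  isomorphism is increasing and cofinal in \<mu>, so the height at \<mu> is at least
  \<open>m + 1\<close>.\<close>

lemma ord_type_le_omega_power:
  fixes c :: "'o::wellorder \<Rightarrow> int"
  assumes succ: "\<And>\<beta>. \<beta> < \<alpha> \<Longrightarrow> 1 \<le> c (ord_succ \<beta>)"
    and lim: "\<And>\<mu>. \<mu> \<le> \<alpha> \<Longrightarrow> ord_limit \<mu> \<Longrightarrow> \<exists>\<beta>\<^sub>0<\<mu>. \<forall>\<beta>. \<beta>\<^sub>0 \<le> \<beta> \<and> \<beta> < \<mu> \<longrightarrow> c \<beta> < c \<mu>"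
    and bound: "\<And>\<beta>. \<beta> \<le> \<alpha> \<Longrightarrow> c \<beta> \<le> int m"
  shows "(ord_type \<alpha>, omega_power m) \<in> ordLeq"
proof (rule ccontr)
  assume "\<not> ?thesis"
  then have "(omega_power m, ord_type \<alpha>) \<in> ordLess"
    using ordLess_or_ordLeq[OF Well_order_omega_power Well_order_ord_type] by blast
  then obtain \<mu> where "\<mu> \<in> Field (ord_type \<alpha>)"
    and iso: "(omega_power m, Restr (ord_type \<alpha>) (underS (ord_type \<alpha>) \<mu>)) \<in> ordIso"
    unfolding ordLess_iff_ordIso_Restr[OF Well_order_ord_type Well_order_omega_power] by blast
  then have \<mu>: "\<mu> < \<alpha>" by (simp add: Field_ord_type)
  let ?r = "Restr (ord_type \<alpha>) (underS (ord_type \<alpha>) \<mu>)"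
  have under: "underS (ord_type \<alpha>) \<mu> = {..<\<mu>}"
    unfolding underS_def ord_type_def using \<mu> by auto
  have r: "(\<beta>, \<gamma>) \<in> ?r \<longleftrightarrow> \<beta> \<le> \<gamma> \<and> \<gamma> < \<mu>" for \<beta> \<gamma>
    unfolding under using \<mu> by (auto simp: ord_type_def)
  have Field_r: "Field ?r = {..<\<mu>}"
    unfolding Field_def Domain_iff Range_iff set_eq_iff Un_iff r by (auto intro: le_less_trans)
  obtain h where "iso (omega_power m) ?r h" using iso unfolding ordIso_def by blast
  then have h: "bij_betw h {xs. length xs = m} {..<\<mu>}"
    "\<And>xs ys. length xs = m \<Longrightarrow> length ys = m \<Longrightarrow> (xs, ys) \<in> omega_power m \<Longrightarrow> (h xs, h ys) \<in> ?r"
    unfolding iso_iff2 Field_r Field_omega_power by blast+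
  have "int m + 1 \<le> c \<mu>"
  proof (rule cofinal_omega_power_height[where \<alpha> = \<alpha> and g = h])
    show "h xs < h ys" if *: "length xs = m" "length ys = m" "(xs, ys) \<in> lexn less_than m" for xs ys
    proof -
      have "xs \<noteq> ys" using *(3) wf_lexn[of less_than m] by auto
      then have "h xs \<noteq> h ys" using h(1) * unfolding bij_betw_def inj_on_def by blast
      moreover have "(h xs, h ys) \<in> ?r" by (rule h(2)) (use * in \<open>auto simp: omega_power_def\<close>)
      ultimately show ?thesis unfolding r by (simp add: order.strict_iff_order)
    qed
    show "h xs < \<mu>" if "length xs = m" for xs
      using h(1) that unfolding bij_betw_def by blast
    show "\<exists>xs. length xs = m \<and> \<beta> \<le> h xs" if "\<beta> < \<mu>" for \<beta>
    proof -
      have "\<beta> \<in> h ` {xs. length xs = m}" using h(1) that unfolding bij_betw_def by simp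
      then show ?thesis by auto
    qed
    show "\<mu> \<le> \<alpha>" using \<mu> by simp
  qed (rule succ lim; assumption)+
  then show False using bound[OF less_imp_le[OF \<mu>]] by simp
qed

section \<open>Greedy reductions\<close>

text \<open>The weight of the constant function 1 is the degree, so this describes a sum of
  \<open>m\<close> chips on \<Gamma>.\<close>

definition effective_on :: "'a set \<Rightarrow> nat \<Rightarrow> 'a divisor \<Rightarrow> bool" where
  "effective_on \<Gamma> m E \<longleftrightarrow> Poly_Mapping.keys E \<subseteq> \<Gamma> \<and> (\<forall>p. 0 \<le> coeff_at E p) \<and> weight (\<lambda>_. 1) E = int m"

text \<open>On effective divisors this is the number of chips in \<open>S\<close>, with
  multiplicity; taken at \<open>insert q V\<close> it is the height for the ordinal
  argument.\<close>

definition chips_in :: "'a set \<Rightarrow> 'a divisor \<Rightarrow> int" where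
  "chips_in S E = weight (indicator S) E"

lemma effective_onD:
  assumes "effective_on \<Gamma> m E"
  shows "Poly_Mapping.keys E \<subseteq> \<Gamma>" "0 \<le> coeff_at E p" "weight (\<lambda>_. 1) E = int m"
  using assms unfolding effective_on_def by simp_all

lemma chips_in_le:
  assumes "effective_on \<Gamma> m E"
  shows "chips_in S E \<le> int m"
proof -
  have "chips_in S E \<le> weight (\<lambda>_. 1) E"
    unfolding chips_in_def weight_def
  proof (rule sum_mono)
    fix p
    have "(indicator S p :: int) \<le> 1" by (simp add: indicator_def)
    then show "of_int (coeff_at E p) * indicator S p \<le> of_int (coeff_at E p) * (1 :: int)"
      using effective_onD(2)[OF assms, of p] by (intro mult_left_mono) simp_all
  qed
  then show ?thesis using effective_onD(3)[OF assms] by simp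
qed

lemma chips_in_pos:
  assumes "effective_on \<Gamma> m E" "v \<in> S" "0 < coeff_at E v"
  shows "1 \<le> chips_in S E"
proof -
  have "1 \<le> of_int (coeff_at E v) * (indicator S v :: int)" using assms(2,3) by simp
  also have "\<dots> \<le> chips_in S E"
    unfolding chips_in_def weight_def
  proof (rule member_le_sum)
    show "v \<in> Poly_Mapping.keys E" using assms(3) by (simp add: in_keys_iff)
    show "0 \<le> of_int (coeff_at E p) * (indicator S p :: int)" for p
      using effective_onD(2)[OF assms(1), of p] by (simp add: indicator_def)
  qed simp
  finally show ?thesis .
qed

lemma chips_in_sum: "chips_in S (\<Sum>j<m. chip (x j)) = int (card {j. j < m \<and> x j \<in> S})"
  for m :: nat
proof -
  have "{..<m} \<inter> {j. x j \<in> S} = {j. j < m \<and> x j \<in> S}" by auto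
  then show ?thesis
    unfolding chips_in_def weight_sum weight_single
    by (simp add: indicator_def of_bool_def sum.If_cases)
qed

lemma chip_at:
  fixes m :: nat
  assumes "coeff_at (\<Sum>j<m. chip (x j)) p \<noteq> 0"
  shows "\<exists>j<m. x j = p"
proof (rule ccontr)
  assume "\<not> ?thesis"
  then have empty: "{j \<in> {..<m}. x j = p} = {}" by auto
  show False using assms unfolding coeff_at_chips[OF finite_lessThan] empty by simp
qed

lemma effective_on_sum:
  fixes m :: nat
  assumes "\<And>j. j < m \<Longrightarrow> x j \<in> \<Gamma>"
  shows "effective_on \<Gamma> m (\<Sum>j<m. chip (x j))"
  unfolding effective_on_def
proof (intro conjI allI)
  show "Poly_Mapping.keys (\<Sum>j<m. chip (x j)) \<subseteq> \<Gamma>"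
  proof
    fix p assume "p \<in> Poly_Mapping.keys (\<Sum>j<m. chip (x j))"
    then have "coeff_at (\<Sum>j<m. chip (x j)) p \<noteq> 0" by (simp only: in_keys_iff not_False_eq_True)
    from chip_at[OF this] show "p \<in> \<Gamma>" using assms by blast
  qed
qed (simp_all add: coeff_at_chips weight_sum weight_single)

section \<open>One legal firing applied to an effective divisor\<close>

context model_firing
begin

text \<open>At \<open>q\<close> the firing takes no chips away, as \<open>q\<close> is in
  \<open>near f\<close>; elsewhere on \<Gamma> legality gives nonnegativity. The degree stays the
  same because \<open>firing_div f\<close> has degree 0.\<close>

lemma effective_on_fire:
  assumes E: "effective_on \<Gamma> m (D + Poly_Mapping.single q N)" and legal: "legal_firing \<Gamma> q D f"
  shows "effective_on \<Gamma> m (D - firing_div f + Poly_Mapping.single q N)"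
proof -
  let ?E = "D + Poly_Mapping.single q N"
  have eq: "D - firing_div f + Poly_Mapping.single q N = ?E - firing_div f" by simp
  have "Poly_Mapping.keys (?E - firing_div f) \<subseteq> \<Gamma>"
  proof
    fix p assume "p \<in> Poly_Mapping.keys (?E - firing_div f)"
    then have "p \<in> Poly_Mapping.keys ?E \<or> p \<in> Poly_Mapping.keys (firing_div f)"
      unfolding in_keys_iff lookup_minus by auto
    then show "p \<in> \<Gamma>" using E keys_firing_div unfolding effective_on_def by blast
  qed
  moreover have "0 \<le> coeff_at (?E - firing_div f) p" for p
  proof -
    consider "p = q" | "p \<noteq> q" "p \<in> \<Gamma>" | "p \<notin> \<Gamma>" by blast
    then show ?thesis
    proof cases
      case 1
      then have "0 \<le> coeff_at ?E p" "coeff_at (firing_div f) p \<le> 0"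
        using E coeff_at_firing_div_near[OF near_far(7)] unfolding effective_on_def by simp_all
      then show ?thesis by (simp add: lookup_minus)
    next
      case 2
      then show ?thesis
        using legal unfolding legal_firing_def by (simp add: lookup_minus lookup_add lookup_single)
    next
      case 3
      then show ?thesis using calculation by (metis in_keys_iff order_refl subsetD)
    qed
  qed
  moreover have "weight (\<lambda>_. 1) (?E - firing_div f) = int m"
    using E unfolding effective_on_def by (simp add: weight_diff weight_firing_div)
  ultimately show ?thesis unfolding eq effective_on_def by blast
qed

text \<open>A far end differs from \<open>q\<close>, so legality requires a chip there for the
  firing to take away.\<close>

lemma coeff_at_seg_end:
  assumes \<sigma>: "\<sigma> \<in> segs f" and legal: "legal_firing \<Gamma> q D f"
  shows "0 < coeff_at D (\<sigma> (len f))"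
proof -
  have "\<sigma> (len f) \<in> \<Gamma>" "\<sigma> (len f) \<noteq> q" using seg(2)[OF \<sigma>] near_far(2,3,7) by auto
  then have "0 \<le> coeff_at (D - firing_div f) (\<sigma> (len f))"
    using legal unfolding legal_firing_def by simp
  then show ?thesis using coeff_at_firing_div_pos(2)[OF \<sigma>] by (simp add: lookup_minus)
qed

end

section \<open>Limit stages and the final bound\<close>

lemma chips_convergeE:
  fixes \<mu> :: "'a::wellorder" and q :: "'b::metric_space"
  assumes "chips_converge \<Gamma> q N Ds \<mu>"
  obtains m :: nat and x where "\<And>\<beta> j. \<beta> \<le> \<mu> \<Longrightarrow> j < m \<Longrightarrow> x \<beta> j \<in> \<Gamma>"
    "\<And>\<beta>. \<beta> \<le> \<mu> \<Longrightarrow> Ds \<beta> + Poly_Mapping.single q N = (\<Sum>j<m. chip (x \<beta> j))"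
    "\<And>j e. j < m \<Longrightarrow> 0 < e \<Longrightarrow>
      \<exists>\<beta>\<^sub>0<\<mu>. \<forall>\<beta>. \<beta>\<^sub>0 \<le> \<beta> \<and> \<beta> < \<mu> \<longrightarrow> dist (x \<beta> j) (x \<mu> j) < e"
proof -
  obtain m :: nat and x
    where *: "\<forall>\<beta>\<le>\<mu>. (\<forall>j<m. x \<beta> j \<in> \<Gamma>) \<and> Ds \<beta> + Poly_Mapping.single q N = (\<Sum>j<m. chip (x \<beta> j))"
    and **: "\<forall>j<m. \<forall>e>0. \<exists>\<beta>\<^sub>0<\<mu>. \<forall>\<beta>. \<beta>\<^sub>0 \<le> \<beta> \<and> \<beta> < \<mu> \<longrightarrow> dist (x \<beta> j) (x \<mu> j) < e"
    using assms unfolding chips_converge_def by (elim exE conjE) (rule that)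
  show thesis
  proof (rule that)
    show "x \<beta> j \<in> \<Gamma>" if "\<beta> \<le> \<mu>" "j < m" for \<beta> j using * that by simp
    show "Ds \<beta> + Poly_Mapping.single q N = (\<Sum>j<m. chip (x \<beta> j))" if "\<beta> \<le> \<mu>" for \<beta>
      using * that by simp
    show "\<exists>\<beta>\<^sub>0<\<mu>. \<forall>\<beta>. \<beta>\<^sub>0 \<le> \<beta> \<and> \<beta> < \<mu> \<longrightarrow> dist (x \<beta> j) (x \<mu> j) < e" if "j < m" "0 < e" for j e
      using ** that by simp
  qed
qed

text \<open>Labels of chips in \<open>insert q V\<close> are compared: close to \<mu> the set of
  labels at \<beta> is contained in the one at \<mu>, and the firing at \<beta> itself refutes
  equality.\<close>

lemma eventually_fewer_chips:
  fixes \<mu> :: "'o::wellorder" and \<Gamma> :: "'a::metric_space set"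
  assumes model: "graph_model \<Gamma> V n w \<phi>"
    and conv: "chips_converge \<Gamma> q N Ds \<mu>" and lim: "ord_limit \<mu>"
    and steps: "\<And>\<beta>. \<beta> < \<mu> \<Longrightarrow>
      \<exists>f. maximal_legal_firing \<Gamma> q (Ds \<beta>) f \<and> Ds (ord_succ \<beta>) = Ds \<beta> - firing_div f"
    and nonneg: "\<And>\<beta> p. \<beta> < \<mu> \<Longrightarrow> 0 \<le> coeff_at (Ds \<beta> + Poly_Mapping.single q N) p"
  shows "\<exists>\<beta>\<^sub>0<\<mu>. \<forall>\<beta>. \<beta>\<^sub>0 \<le> \<beta> \<and> \<beta> < \<mu> \<longrightarrow>
    chips_in (insert q V) (Ds \<beta> + Poly_Mapping.single q N)
      < chips_in (insert q V) (Ds \<mu> + Poly_Mapping.single q N)"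
proof -
  let ?V = "insert q V"
  let ?E = "\<lambda>\<beta>. Ds \<beta> + Poly_Mapping.single q N"
  obtain m :: nat and x where x\<Gamma>: "\<And>\<beta> j. \<beta> \<le> \<mu> \<Longrightarrow> j < m \<Longrightarrow> x \<beta> j \<in> \<Gamma>"
    and E: "\<And>\<beta>. \<beta> \<le> \<mu> \<Longrightarrow> ?E \<beta> = (\<Sum>j<m. chip (x \<beta> j))"
    and x_lim: "\<And>j e. j < m \<Longrightarrow> 0 < e \<Longrightarrow>
      \<exists>\<beta>\<^sub>0<\<mu>. \<forall>\<beta>. \<beta>\<^sub>0 \<le> \<beta> \<and> \<beta> < \<mu> \<longrightarrow> dist (x \<beta> j) (x \<mu> j) < e"
    by (rule chips_convergeE[OF conv]) (rule that)
  \<comment> \<open>Vertices, \<open>q\<close> and limit positions form a finite set; \<delta> is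
    chosen so that two of its points within \<open>2 * \<delta>\<close> of each other
    coincide.\<close>
  define P where "P = ?V \<union> x \<mu> ` {..<m}"
  define S where "S = (\<lambda>(a, b). dist a b) ` {(a, b) \<in> P \<times> P. a \<noteq> b}"
  have "finite P" unfolding P_def using graph_model_vertices[OF model] by simp
  then have "finite (P \<times> P)" by simp
  then have "finite S" unfolding S_def by (rule finite_imageI[OF finite_subset[rotated]]) auto
  moreover have "0 < d" if "d \<in> S" for d using that unfolding S_def by auto
  ultimately obtain \<delta> where \<delta>: "0 < \<delta>" and \<delta>_S: "\<And>d. d \<in> S \<Longrightarrow> 2 * \<delta> < d"
    using finite_positive_bound by blast
  have sep: "a = b" if ab: "a \<in> P" "b \<in> P" "dist a b \<le> 2 * \<delta>" for a b
  proof (rule ccontr)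
    assume "a \<noteq> b"
    then have "dist a b \<in> S" unfolding S_def using ab by force
    from \<delta>_S[OF this] show False using ab(3) by simp
  qed
  \<comment> \<open>Each chip will move by at most \<open>2 * e\<close>, all \<open>m\<close> of
    them together by less than \<delta>. The summand 2 covers \<open>m = 0\<close>.\<close>
  define e where "e = \<delta> / (2 * real m + 2)"
  have e: "0 < e" "e < \<delta>" "2 * e * real m < \<delta>"
    using \<delta> by (simp_all add: e_def field_simps add_pos_nonneg)
  obtain b where b: "\<And>j. j < m \<Longrightarrow> b j < \<mu>"
    "\<And>j \<beta>. j < m \<Longrightarrow> b j \<le> \<beta> \<Longrightarrow> \<beta> < \<mu> \<Longrightarrow> dist (x \<beta> j) (x \<mu> j) < e"
    using x_lim[OF _ e(1)] by metis
  obtain b' where "b' < \<mu>" using lim unfolding ord_limit_def by blast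
  \<comment> \<open>The element \<open>b'\<close> keeps the maximum defined, and below \<mu>, when
    there are no chips.\<close>
  define \<beta>\<^sub>0 where "\<beta>\<^sub>0 = Max (insert b' (b ` {..<m}))"
  have "\<beta>\<^sub>0 \<in> insert b' (b ` {..<m})" unfolding \<beta>\<^sub>0_def by (rule Max_in) auto
  then have "\<beta>\<^sub>0 < \<mu>" using b(1) \<open>b' < \<mu>\<close> by auto
  have close: "dist (x \<beta> j) (x \<mu> j) < e" if "j < m" "\<beta>\<^sub>0 \<le> \<beta>" "\<beta> < \<mu>" for j \<beta>
  proof (rule b(2)[OF that(1) _ that(3)])
    have "b j \<le> \<beta>\<^sub>0" unfolding \<beta>\<^sub>0_def by (rule Max_ge) (use that(1) in auto)
    then show "b j \<le> \<beta>" using that(2) by simp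
  qed
  have "chips_in ?V (?E \<beta>) < chips_in ?V (?E \<mu>)" if \<beta>: "\<beta>\<^sub>0 \<le> \<beta>" "\<beta> < \<mu>" for \<beta>
  proof -
    let ?J = "\<lambda>\<beta>. {j. j < m \<and> x \<beta> j \<in> ?V}"
    have succ: "\<beta> < ord_succ \<beta>" "ord_succ \<beta> < \<mu>"
    proof -
      obtain \<gamma> where \<gamma>: "\<beta> < \<gamma>" "\<gamma> < \<mu>" using lim \<beta>(2) unfolding ord_limit_def by blast
      then show "\<beta> < ord_succ \<beta>" "ord_succ \<beta> < \<mu>"
        using less_ord_succ[OF \<gamma>(1)] ord_succ_le[OF \<gamma>(1)] by auto
    qed
    \<comment> \<open>A chip in \<open>insert q V\<close> that is close to its limit is already
      there, because both positions belong to \<open>P\<close>.\<close>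
    have sub: "?J \<beta> \<subseteq> ?J \<mu>"
    proof
      fix j assume "j \<in> ?J \<beta>"
      then have j: "j < m" "x \<beta> j \<in> ?V" by auto
      have "x \<beta> j = x \<mu> j"
        by (rule sep) (use j close[OF j(1) \<beta>] e(2) \<delta> in \<open>auto simp: P_def\<close>)
      then show "j \<in> ?J \<mu>" using j by simp
    qed
    have "?J \<beta> \<noteq> ?J \<mu>"
    proof
      assume same: "?J \<beta> = ?J \<mu>"
      obtain f where f: "maximal_legal_firing \<Gamma> q (Ds \<beta>) f" "Ds (ord_succ \<beta>) = Ds \<beta> - firing_div f"
        using steps[OF \<beta>(2)] by blast
      then have legal: "legal_firing \<Gamma> q (Ds \<beta>) f" by (simp add: maximal_legal_firing_def)
      interpret model_firing \<Gamma> V n w \<phi> q f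
        by unfold_locales (use model legal in \<open>simp_all add: legal_firing_def\<close>)
      have "0 \<le> coeff_at (Ds \<beta>) p" if "p \<noteq> q" for p
        using nonneg[OF \<beta>(2), of p] that by (simp add: lookup_add lookup_single)
      then obtain \<sigma> where \<sigma>: "\<sigma> \<in> segs f" "\<sigma> 0 \<in> ?V"
        using maximal_firing_hits_vertex[OF _ f(1)] by fast
      have "card (segs f) \<noteq> 0" using \<sigma>(1) near_far(9) by auto
      then have "1 * len f \<le> real (card (segs f)) * len f"
        using near_far(8) by (intro mult_right_mono) auto
      \<comment> \<open>The labels of the convergence need not follow the chips that
        \<open>f\<close> moves; the energy bound holds for every labelling.\<close>
      also have "\<dots> \<le> (\<Sum>j<m. dist (x \<beta> j) (x (ord_succ \<beta>) j))"
      proof (rule energy_bound)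
        have "?E \<beta> - firing_div f = ?E (ord_succ \<beta>)" using f(2) by simp
        then show "?E \<beta> - firing_div f = (\<Sum>j<m. chip (x (ord_succ \<beta>) j))"
          using E[of "ord_succ \<beta>"] succ by simp
      qed (use x\<Gamma> E \<beta> succ in auto)
      also have "\<dots> \<le> (\<Sum>j<m. 2 * e)"
      proof (rule sum_mono)
        fix j assume "j \<in> {..<m}"
        moreover have "\<beta>\<^sub>0 \<le> ord_succ \<beta>" using \<beta>(1) succ(1) by (rule order.trans[OF _ less_imp_le])
        ultimately show "dist (x \<beta> j) (x (ord_succ \<beta>) j) \<le> 2 * e"
          using close[of j \<beta>] close[of j "ord_succ \<beta>"] \<beta> succ
            dist_triangle2[of "x \<beta> j" "x (ord_succ \<beta>) j" "x \<mu> j"] by auto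
      qed
      also have "\<dots> < \<delta>" using e(3) by (simp add: mult.commute)
      finally have len: "len f < \<delta>" by simp
      let ?y = "\<sigma> (len f)"
      have y: "dist (\<sigma> 0) ?y = len f" using seg_isometric[OF \<sigma>(1), of 0 "len f"] near_far(8) by simp
      have "?y \<noteq> q" using seg(2)[OF \<sigma>(1)] near_far(3,7) by auto
      then have "0 < coeff_at (?E \<beta>) ?y"
        using coeff_at_seg_end[OF \<sigma>(1) legal] by (simp add: lookup_add lookup_single)
      then obtain j where j: "j < m" "x \<beta> j = ?y"
        using chip_at[where m = m and x = "x \<beta>" and p = ?y] E[OF less_imp_le[OF \<beta>(2)]] by auto
      \<comment> \<open>The chip at the far end must converge to the vertex
        \<open>\<sigma> 0\<close>. Equality of the label sets then puts it in
        \<open>insert q V\<close> already at stage \<beta>, so it sits at \<open>\<sigma> 0\<close>,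
        although it is \<open>len f\<close> away.\<close>
      have "dist (\<sigma> 0) (x \<mu> j) \<le> 2 * \<delta>"
        using close[OF j(1) \<beta>] dist_triangle[of "\<sigma> 0" "x \<mu> j" ?y] y len e(2) j(2) by simp
      then have "\<sigma> 0 = x \<mu> j"
        using \<sigma>(2) j(1) by (intro sep) (auto simp: P_def)
      then have "j \<in> ?J \<beta>" using \<sigma>(2) j(1) unfolding same by simp
      then have "\<sigma> 0 = ?y"
        using \<sigma>(2) j y len \<delta> by (intro sep) (auto simp: P_def)
      then show False using y near_far(8) by simp
    qed
    then have "card (?J \<beta>) < card (?J \<mu>)"
      using sub by (intro psubset_card_mono) auto
    then show ?thesis using E[of \<beta>] E[of \<mu>] \<beta>(2) by (simp add: chips_in_sum)
  qed
  then show ?thesis using \<open>\<beta>\<^sub>0 < \<mu>\<close> by blast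
qed

text \<open>The exponent is the number of chips after the debt at \<open>q\<close> has been covered.
  It is the degree of \<open>D\<close> if \<open>D\<close> is nonnegative at \<open>q\<close>, and
  exceeds the degree by the debt otherwise.\<close>

theorem lemma3:
  fixes \<Gamma> :: "'a::metric_space set" and q :: 'a and D :: "'a divisor"
    and \<alpha> :: "'o::wellorder" and Ds :: "'o \<Rightarrow> 'a divisor"
  assumes "metric_graph \<Gamma>"
    and "q \<in> \<Gamma>"
    and "is_divisor_on \<Gamma> D"
    and "\<forall>p\<in>\<Gamma>. p \<noteq> q \<longrightarrow> 0 \<le> coeff_at D p"
    and "greedy_reduction \<Gamma> q D \<alpha> Ds"
  shows "(ord_type \<alpha>, omega_power (nat (div_deg D + max 0 (- coeff_at D q)))) \<in> ordLeq"
proof -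
  obtain V n w \<phi> where model: "graph_model \<Gamma> V n w \<phi>"
    using assms(1) unfolding metric_graph_def by blast
  define N where "N = max 0 (- coeff_at D q)"
  define m where "m = nat (div_deg D + N)"
  define E where "E \<beta> = Ds \<beta> + Poly_Mapping.single q N" for \<beta>
  have start: "Ds ord_zero = D"
    and steps: "\<And>\<beta>. \<beta> < \<alpha> \<Longrightarrow>
      \<exists>f. maximal_legal_firing \<Gamma> q (Ds \<beta>) f \<and> Ds (ord_succ \<beta>) = Ds \<beta> - firing_div f"
    and lims: "\<And>\<mu>. \<mu> \<le> \<alpha> \<Longrightarrow> ord_limit \<mu> \<Longrightarrow> chips_converge \<Gamma> q N Ds \<mu>"
    using assms(5) unfolding greedy_reduction_def N_def by simp_all
  have interp: "model_firing \<Gamma> V n w \<phi> q f \<and> legal_firing \<Gamma> q D' f"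
    if "maximal_legal_firing \<Gamma> q D' f" for D' f
    using that model by (simp add: maximal_legal_firing_def legal_firing_def model_firing_def)
  have eff0: "effective_on \<Gamma> m (E ord_zero)"
  proof -
    have "Poly_Mapping.keys (E ord_zero) \<subseteq> \<Gamma>"
      using assms(2,3) Poly_Mapping.keys_add[of D "Poly_Mapping.single q N"]
      unfolding E_def start is_divisor_on_def by (auto split: if_splits)
    moreover have nonneg: "0 \<le> coeff_at (E ord_zero) p" for p
    proof -
      consider "p = q" | "p \<noteq> q" "p \<in> \<Gamma>" | "p \<noteq> q" "p \<notin> Poly_Mapping.keys D"
        using assms(3) unfolding is_divisor_on_def by blast
      then show ?thesis
        by cases (use assms(4) in
          \<open>simp_all add: E_def start N_def lookup_add lookup_single in_keys_iff\<close>)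
    qed
    moreover have deg: "weight (\<lambda>_. 1) (E ord_zero) = div_deg D + N"
      unfolding E_def start weight_add weight_single by (simp add: weight_def div_deg_def)
    \<comment> \<open>Nonnegativity of the degree ensures that \<open>nat\<close> in the definition
      of \<open>m\<close> loses nothing.\<close>
    moreover have "(0::int) \<le> weight (\<lambda>_. 1) (E ord_zero)"
      unfolding weight_def using nonneg by (intro sum_nonneg) simp
    ultimately show ?thesis unfolding effective_on_def m_def by simp
  qed
  have eff: "effective_on \<Gamma> m (E \<beta>)" if "\<beta> \<le> \<alpha>" for \<beta>
    using that
  proof (induction \<beta> rule: less_induct)
    case (less \<beta>)
    show ?case
    proof (cases \<beta> rule: ord_cases)
      case 1
      then show ?thesis using eff0 by simp
    next
      case (2 \<gamma>)
      then obtain f where f: "maximal_legal_firing \<Gamma> q (Ds \<gamma>) f" "Ds \<beta> = Ds \<gamma> - firing_div f"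
        using steps[of \<gamma>] less.prems less_le_trans[OF 2(1) less.prems] by auto
      then interpret model_firing \<Gamma> V n w \<phi> q f using interp by blast
      show ?thesis
        unfolding E_def f(2)
        by (rule effective_on_fire) (use less.IH[OF 2(1)] 2(1) less.prems interp[OF f(1)] in \<open>auto simp: E_def\<close>)
    next
      case 3
      then obtain \<gamma> where \<gamma>: "\<gamma> < \<beta>" unfolding ord_limit_def by blast
      obtain m' :: nat and x where x: "\<And>\<gamma> j. \<gamma> \<le> \<beta> \<Longrightarrow> j < m' \<Longrightarrow> x \<gamma> j \<in> \<Gamma>"
        "\<And>\<gamma>. \<gamma> \<le> \<beta> \<Longrightarrow> Ds \<gamma> + Poly_Mapping.single q N = (\<Sum>j<m'. chip (x \<gamma> j))"
        by (rule chips_convergeE[OF lims[OF less.prems 3]]) (rule that)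
      have "effective_on \<Gamma> m' (E \<delta>)" if "\<delta> \<le> \<beta>" for \<delta>
        unfolding E_def x(2)[OF that] by (rule effective_on_sum) (rule x(1)[OF that])
      \<comment> \<open>Convergence brings its own number \<open>m'\<close> of chips; comparing
        degrees at an earlier stage identifies it with \<open>m\<close>.\<close>
      moreover have "effective_on \<Gamma> m (E \<gamma>)" using less \<gamma> by simp
      ultimately show ?thesis using \<gamma> unfolding effective_on_def by (metis less_imp_le order_refl)
    qed
  qed
  have "(ord_type \<alpha>, omega_power m) \<in> ordLeq"
  proof (rule ord_type_le_omega_power[where c = "\<lambda>\<beta>. chips_in (insert q V) (E \<beta>)"])
    show "chips_in (insert q V) (E \<beta>) \<le> int m" if "\<beta> \<le> \<alpha>" for \<beta>
      by (rule chips_in_le[OF eff[OF that]])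
  next
    fix \<beta> assume \<beta>: "\<beta> < \<alpha>"
    obtain f where f: "maximal_legal_firing \<Gamma> q (Ds \<beta>) f" "Ds (ord_succ \<beta>) = Ds \<beta> - firing_div f"
      using steps[OF \<beta>] by blast
    then interpret model_firing \<Gamma> V n w \<phi> q f using interp by blast
    have nonneg: "0 \<le> coeff_at (E \<beta>) p" for p
      using eff[of \<beta>] \<beta> unfolding effective_on_def by simp
    have "0 \<le> coeff_at (Ds \<beta>) p" if "p \<noteq> q" for p
      using nonneg[of p] that by (simp add: E_def lookup_add lookup_single)
    then obtain \<sigma> where \<sigma>: "\<sigma> \<in> segs f" "\<sigma> 0 \<in> insert q V"
      using maximal_firing_hits_vertex[OF _ f(1)] by fast
    have "E (ord_succ \<beta>) = E \<beta> - firing_div f" unfolding E_def f(2) by simp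
    then have "0 < coeff_at (E (ord_succ \<beta>)) (\<sigma> 0)"
      using nonneg[of "\<sigma> 0"] coeff_at_firing_div_pos(1)[OF \<sigma>(1)] by (simp add: lookup_minus)
    then show "1 \<le> chips_in (insert q V) (E (ord_succ \<beta>))"
      by (rule chips_in_pos[OF eff[OF ord_succ_le[OF \<beta>]] \<sigma>(2)])
  next
    fix \<mu> assume \<mu>: "\<mu> \<le> \<alpha>" "ord_limit \<mu>"
    have "0 \<le> coeff_at (E \<beta>) p" if "\<beta> < \<mu>" for \<beta> p
      using eff[of \<beta>] that \<mu>(1) unfolding effective_on_def by simp
    then show "\<exists>\<beta>\<^sub>0<\<mu>. \<forall>\<beta>. \<beta>\<^sub>0 \<le> \<beta> \<and> \<beta> < \<mu> \<longrightarrow>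
        chips_in (insert q V) (E \<beta>) < chips_in (insert q V) (E \<mu>)"
      using eventually_fewer_chips[OF model lims[OF \<mu>] \<mu>(2) steps] \<mu>(1) unfolding E_def by simp
  qed
  then show ?thesis unfolding m_def N_def .
qed

end
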